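(* Let $H$ be a Hopf algebra and $E$ an $H$-comodule algebra. There is an isomorphism of pointed sets $\mathcal{H}^1(H,E)\cong\mathcal{T}ors(H,E)$, induced by sending a Hopf $1$-cocycle $X$ to the class of the torsor $(E,\Delta_E^X)$, where $\Delta_E^X(x)=X\Delta_E(x)$.
   Context: An $H$-comodule algebra is an algebra $E$ with coaction $\Delta_E:E\to E\otimes H$ that is an algebra morphism. An $(H,E)$-Hopf module is a right $E$-module $T$ with right $H$-coaction $\Delta_T$ such that $\Delta_T(tx)=\Delta_T(t)\Delta_E(x)$; morphisms are $E$-linear $H$-colinear maps. For a right module $T$ over an algebra $A$ and $u\in T$, $\vartheta_u(x)=ux$ and $T^\times=\{u:\vartheta_u:A\to T\text{ bijective}\}$ (applied to $T$ over $E$ and $T\otimes H$ over $E\otimes H$). $T^\bullet=\{u\in T^\times:\Delta_T(u)\in(T\otimes H)^\times\}$. An $(H,E)$-Hopf torsor is an $(H,E)$-Hopf module with $T^\bullet\neq\emptyset$; $\mathcal{T}ors(H,E)$ is the set of isomorphism classes of $(H,E)$-Hopf torsors (isomorphism as $(H,E)$-Hopf modules), pointed by the class of $(E,\Delta_E)$. General cohomology: $d^0(x)=\Delta_E(x)$, $d^1(x)=x\otimes1$; $d^0(X)=(\Delta_E\otimes\mathrm{id})(X)$, $d^1(X)=(\mathrm{id}\otimes\Delta_H)(X)$, $d^2(X)=X\otimes1$; $\mathcal{Z}^1(H,E)=\{X\in(E\otimes H)^\times:d^2(X)d^0(X)=d^1(X)\}$; $\mathcal{H}^1(H,E)=E^\times\backslash\mathcal{Z}^1(H,E)$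 under $X\leftharpoonup x=d^1(x^{-1})Xd^0(x)$, pointed by the class of $1\otimes1$. *)

theory Defs
  imports Main
begin

record ('k,'a) kmod =
  mcar :: "'a set"
  madd :: "'a \<Rightarrow> 'a \<Rightarrow> 'a"
  mzero :: "'a"
  msmul :: "'k \<Rightarrow> 'a \<Rightarrow> 'a"

record ('k,'a) kalg = "('k,'a) kmod" +
  mmul :: "'a \<Rightarrow> 'a \<Rightarrow> 'a"
  mone :: "'a"

definition kmodule :: "('k::field,'a,'c) kmod_scheme \<Rightarrow> bool" where
  "kmodule M \<longleftrightarrow>
     mzero M \<in> mcar M \<and>
     (\<forall>x\<in>mcar M. \<forall>y\<in>mcar M. madd M x y \<in> mcar M) \<and>
     (\<forall>c. \<forall>x\<in>mcar M. msmul M c x \<in> mcar M) \<and>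
     (\<forall>x\<in>mcar M. \<forall>y\<in>mcar M. \<forall>z\<in>mcar M. madd M (madd M x y) z = madd M x (madd M y z)) \<and>
     (\<forall>x\<in>mcar M. \<forall>y\<in>mcar M. madd M x y = madd M y x) \<and>
     (\<forall>x\<in>mcar M. madd M (mzero M) x = x) \<and>
     (\<forall>x\<in>mcar M. \<exists>y\<in>mcar M. madd M x y = mzero M) \<and>
     (\<forall>c d. \<forall>x\<in>mcar M. msmul M (c * d) x = msmul M c (msmul M d x)) \<and>
     (\<forall>x\<in>mcar M. msmul M 1 x = x) \<and>
     (\<forall>c d. \<forall>x\<in>mcar M. msmul M (c + d) x = madd M (msmul M c x) (msmul M d x)) \<and>
     (\<forall>c. \<forall>x\<in>mcar M. \<forall>y\<in>mcar M. msmul M c (madd M x y) = madd M (msmul M c x) (msmul M c y))"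

definition klinear :: "('k::field,'a,'c) kmod_scheme \<Rightarrow> ('k,'b,'d) kmod_scheme \<Rightarrow> ('a \<Rightarrow> 'b) \<Rightarrow> bool" where
  "klinear M N f \<longleftrightarrow>
     (\<forall>x\<in>mcar M. f x \<in> mcar N) \<and>
     (\<forall>x\<in>mcar M. \<forall>y\<in>mcar M. f (madd M x y) = madd N (f x) (f y)) \<and>
     (\<forall>c. \<forall>x\<in>mcar M. f (msmul M c x) = msmul N c (f x))"

definition kalgebra :: "('k::field,'a,'c) kalg_scheme \<Rightarrow> bool" where
  "kalgebra A \<longleftrightarrow> kmodule A \<and>
     mone A \<in> mcar A \<and>
     (\<forall>x\<in>mcar A. \<forall>y\<in>mcar A. mmul A x y \<in> mcar A) \<and>
     (\<forall>x\<in>mcar A. \<forall>y\<in>mcar A. \<forall>z\<in>mcar A. mmul A (mmul A x y) z = mmul A x (mmul A y z)) \<and>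
     (\<forall>x\<in>mcar A. mmul A (mone A) x = x \<and> mmul A x (mone A) = x) \<and>
     (\<forall>x\<in>mcar A. \<forall>y\<in>mcar A. \<forall>z\<in>mcar A.
        mmul A x (madd A y z) = madd A (mmul A x y) (mmul A x z) \<and>
        mmul A (madd A x y) z = madd A (mmul A x z) (mmul A y z)) \<and>
     (\<forall>c. \<forall>x\<in>mcar A. \<forall>y\<in>mcar A.
        mmul A (msmul A c x) y = msmul A c (mmul A x y) \<and>
        mmul A x (msmul A c y) = msmul A c (mmul A x y))"

definition alg_hom :: "('k::field,'a,'c) kalg_scheme \<Rightarrow> ('k,'b,'d) kalg_scheme \<Rightarrow> ('a \<Rightarrow> 'b) \<Rightarrow> bool" where
  "alg_hom A B f \<longleftrightarrow> klinear A B f \<and>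
     (\<forall>x\<in>mcar A. \<forall>y\<in>mcar A. f (mmul A x y) = mmul B (f x) (f y)) \<and>
     f (mone A) = mone B"

definition alg_units :: "('k,'a,'c) kalg_scheme \<Rightarrow> 'a set" where
  "alg_units A = {x \<in> mcar A. \<exists>y\<in>mcar A. mmul A x y = mone A \<and> mmul A y x = mone A}"

section \<open>Tensor product of k-modules (free module on M x N modulo bilinearity)\<close>

definition tfree :: "('k::field,'a,'c) kmod_scheme \<Rightarrow> ('k,'b,'d) kmod_scheme \<Rightarrow> ('a \<times> 'b \<Rightarrow> 'k) set" where
  "tfree M N = {f. finite {p. f p \<noteq> 0} \<and> {p. f p \<noteq> 0} \<subseteq> mcar M \<times> mcar N}"

definition tdelta :: "'a \<Rightarrow> 'b \<Rightarrow> ('a \<times> 'b \<Rightarrow> 'k::field)" where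
  "tdelta a b = (\<lambda>p. if p = (a, b) then 1 else 0)"

definition trels :: "('k::field,'a,'c) kmod_scheme \<Rightarrow> ('k,'b,'d) kmod_scheme \<Rightarrow> ('a \<times> 'b \<Rightarrow> 'k) set" where
  "trels M N =
     {(\<lambda>p. tdelta (madd M a a') b p - tdelta a b p - tdelta a' b p) | a a' b.
         a \<in> mcar M \<and> a' \<in> mcar M \<and> b \<in> mcar N} \<union>
     {(\<lambda>p. tdelta a (madd N b b') p - tdelta a b p - tdelta a b' p) | a b b'.
         a \<in> mcar M \<and> b \<in> mcar N \<and> b' \<in> mcar N} \<union>
     {(\<lambda>p. tdelta (msmul M c a) b p - c * tdelta a b p) | c a b.
         a \<in> mcar M \<and> b \<in> mcar N} \<union>
     {(\<lambda>p. tdelta a (msmul N c b) p - c * tdelta a b p) | c a b.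
         a \<in> mcar M \<and> b \<in> mcar N}"

inductive_set kspan :: "('x \<Rightarrow> 'k::field) set \<Rightarrow> ('x \<Rightarrow> 'k) set" for S where
  kspan_zero: "(\<lambda>_. 0) \<in> kspan S"
| kspan_step: "s \<in> S \<Longrightarrow> t \<in> kspan S \<Longrightarrow> (\<lambda>p. c * s p + t p) \<in> kspan S"

definition tclass :: "('k::field,'a,'c) kmod_scheme \<Rightarrow> ('k,'b,'d) kmod_scheme \<Rightarrow> ('a \<times> 'b \<Rightarrow> 'k) \<Rightarrow> ('a \<times> 'b \<Rightarrow> 'k) set" where
  "tclass M N f = {g \<in> tfree M N. (\<lambda>p. f p - g p) \<in> kspan (trels M N)}"

definition tcar :: "('k::field,'a,'c) kmod_scheme \<Rightarrow> ('k,'b,'d) kmod_scheme \<Rightarrow> ('a \<times> 'b \<Rightarrow> 'k) set set" where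
  "tcar M N = tclass M N ` tfree M N"

definition trep :: "('x \<Rightarrow> 'k) set \<Rightarrow> 'x \<Rightarrow> 'k" where
  "trep X = (SOME f. f \<in> X)"

definition tsupp :: "('x \<Rightarrow> 'k::zero) \<Rightarrow> 'x set" where
  "tsupp f = {p. f p \<noteq> 0}"

definition msum :: "('k,'p,'c) kmod_scheme \<Rightarrow> ('x \<Rightarrow> 'p) \<Rightarrow> 'x set \<Rightarrow> 'p" where
  "msum P g S = Finite_Set.fold (\<lambda>x acc. madd P (g x) acc) (mzero P) S"

text \<open>Linear extension of a bilinear map beta out of a tensor product M (x) N into P.\<close>
definition tlift :: "('k::field,'p,'c) kmod_scheme \<Rightarrow> ('a \<Rightarrow> 'b \<Rightarrow> 'p) \<Rightarrow> ('a \<times> 'b \<Rightarrow> 'k) set \<Rightarrow> 'p" where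
  "tlift P \<beta> X = msum P (\<lambda>p. msmul P (trep X p) (\<beta> (fst p) (snd p))) (tsupp (trep X))"

definition tpure :: "('k::field,'a,'c) kmod_scheme \<Rightarrow> ('k,'b,'d) kmod_scheme \<Rightarrow> 'a \<Rightarrow> 'b \<Rightarrow> ('a \<times> 'b \<Rightarrow> 'k) set" where
  "tpure M N a b = tclass M N (tdelta a b)"

definition tensor :: "('k::field,'a,'c) kmod_scheme \<Rightarrow> ('k,'b,'d) kmod_scheme \<Rightarrow> ('k, ('a \<times> 'b \<Rightarrow> 'k) set) kmod" where
  "tensor M N =
     \<lparr> mcar = tcar M N,
       madd = (\<lambda>X Y. tclass M N (\<lambda>p. trep X p + trep Y p)),
       mzero = tclass M N (\<lambda>_. 0),
       msmul = (\<lambda>c X. tclass M N (\<lambda>p. c * trep X p)) \<rparr>"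

definition tmap :: "('k::field,'a,'c) kmod_scheme \<Rightarrow> ('k,'b,'d) kmod_scheme \<Rightarrow> ('x \<Rightarrow> 'a) \<Rightarrow> ('y \<Rightarrow> 'b)
                     \<Rightarrow> ('x \<times> 'y \<Rightarrow> 'k) set \<Rightarrow> ('a \<times> 'b \<Rightarrow> 'k) set" where
  "tmap M' N' f g X = tlift (tensor M' N') (\<lambda>a b. tpure M' N' (f a) (g b)) X"

definition tensor_alg :: "('k::field,'a,'c) kalg_scheme \<Rightarrow> ('k,'b,'d) kalg_scheme \<Rightarrow> ('k, ('a \<times> 'b \<Rightarrow> 'k) set) kalg" where
  "tensor_alg A B =
     \<lparr> mcar = tcar A B,
       madd = (\<lambda>X Y. tclass A B (\<lambda>p. trep X p + trep Y p)),
       mzero = tclass A B (\<lambda>_. 0),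
       msmul = (\<lambda>c X. tclass A B (\<lambda>p. c * trep X p)),
       mmul = (\<lambda>X Y. tlift (tensor A B)
                 (\<lambda>a b. tlift (tensor A B) (\<lambda>a' b'. tpure A B (mmul A a a') (mmul B b b')) Y) X),
       mone = tpure A B (mone A) (mone B) \<rparr>"

definition assoc_inv :: "('k::field,'a,'c) kmod_scheme \<Rightarrow> ('k,'b,'d) kmod_scheme \<Rightarrow> ('k,'e,'f) kmod_scheme
        \<Rightarrow> ('a \<times> (('b \<times> 'e \<Rightarrow> 'k) set) \<Rightarrow> 'k) set \<Rightarrow> ((('a \<times> 'b \<Rightarrow> 'k) set) \<times> 'e \<Rightarrow> 'k) set" where
  "assoc_inv M N P X =
     tlift (tensor (tensor M N) P)
       (\<lambda>a y. tlift (tensor (tensor M N) P) (\<lambda>b c. tpure (tensor M N) P (tpure M N a b) c) y) X"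

definition hopf_algebra :: "('k::field,'h,'c) kalg_scheme \<Rightarrow> ('h \<Rightarrow> ('h \<times> 'h \<Rightarrow> 'k) set)
        \<Rightarrow> ('h \<Rightarrow> 'k) \<Rightarrow> ('h \<Rightarrow> 'h) \<Rightarrow> bool" where
  "hopf_algebra H \<Delta> \<epsilon> S \<longleftrightarrow>
     kalgebra H \<and>
     alg_hom H (tensor_alg H H) \<Delta> \<and>
     (\<forall>x\<in>mcar H. \<forall>y\<in>mcar H. \<epsilon> (madd H x y) = \<epsilon> x + \<epsilon> y) \<and>
     (\<forall>c. \<forall>x\<in>mcar H. \<epsilon> (msmul H c x) = c * \<epsilon> x) \<and>
     (\<forall>x\<in>mcar H. \<forall>y\<in>mcar H. \<epsilon> (mmul H x y) = \<epsilon> x * \<epsilon> y) \<and>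
     \<epsilon> (mone H) = 1 \<and>
     (\<forall>h\<in>mcar H. tmap (tensor H H) H \<Delta> id (\<Delta> h) = assoc_inv H H H (tmap H (tensor H H) id \<Delta> (\<Delta> h))) \<and>
     (\<forall>h\<in>mcar H. tlift H (\<lambda>a b. msmul H (\<epsilon> a) b) (\<Delta> h) = h) \<and>
     (\<forall>h\<in>mcar H. tlift H (\<lambda>a b. msmul H (\<epsilon> b) a) (\<Delta> h) = h) \<and>
     klinear H H S \<and>
     (\<forall>h\<in>mcar H. tlift H (\<lambda>a b. mmul H (S a) b) (\<Delta> h) = msmul H (\<epsilon> h) (mone H)) \<and>
     (\<forall>h\<in>mcar H. tlift H (\<lambda>a b. mmul H a (S b)) (\<Delta> h) = msmul H (\<epsilon> h) (mone H))"

definition comodule_algebra :: "('k::field,'h,'c) kalg_scheme \<Rightarrow> ('h \<Rightarrow> ('h \<times> 'h \<Rightarrow> 'k) set) \<Rightarrow> ('h \<Rightarrow> 'k)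
        \<Rightarrow> ('k,'e,'d) kalg_scheme \<Rightarrow> ('e \<Rightarrow> ('e \<times> 'h \<Rightarrow> 'k) set) \<Rightarrow> bool" where
  "comodule_algebra H \<Delta> \<epsilon> E \<Delta>E \<longleftrightarrow>
     kalgebra E \<and>
     alg_hom E (tensor_alg E H) \<Delta>E \<and>
     (\<forall>x\<in>mcar E. tmap (tensor E H) H \<Delta>E id (\<Delta>E x) = assoc_inv E H H (tmap E (tensor H H) id \<Delta> (\<Delta>E x))) \<and>
     (\<forall>x\<in>mcar E. tlift E (\<lambda>y h. msmul E (\<epsilon> h) y) (\<Delta>E x) = x)"

definition rmodule :: "('k::field,'a,'c) kalg_scheme \<Rightarrow> ('k,'t,'d) kmod_scheme \<Rightarrow> ('t \<Rightarrow> 'a \<Rightarrow> 't) \<Rightarrow> bool" where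
  "rmodule A T act \<longleftrightarrow>
     kmodule T \<and>
     (\<forall>t\<in>mcar T. \<forall>x\<in>mcar A. act t x \<in> mcar T) \<and>
     (\<forall>t\<in>mcar T. \<forall>x\<in>mcar A. \<forall>y\<in>mcar A. act t (mmul A x y) = act (act t x) y) \<and>
     (\<forall>t\<in>mcar T. act t (mone A) = t) \<and>
     (\<forall>t\<in>mcar T. \<forall>t'\<in>mcar T. \<forall>x\<in>mcar A. act (madd T t t') x = madd T (act t x) (act t' x)) \<and>
     (\<forall>t\<in>mcar T. \<forall>x\<in>mcar A. \<forall>y\<in>mcar A. act t (madd A x y) = madd T (act t x) (act t y)) \<and>
     (\<forall>c. \<forall>t\<in>mcar T. \<forall>x\<in>mcar A. act t (msmul A c x) = msmul T c (act t x)) \<and>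
     (\<forall>c. \<forall>t\<in>mcar T. msmul T c t = act t (msmul A c (mone A)))"

definition rcomodule :: "('k::field,'h,'c) kalg_scheme \<Rightarrow> ('h \<Rightarrow> ('h \<times> 'h \<Rightarrow> 'k) set) \<Rightarrow> ('h \<Rightarrow> 'k)
        \<Rightarrow> ('k,'t,'d) kmod_scheme \<Rightarrow> ('t \<Rightarrow> ('t \<times> 'h \<Rightarrow> 'k) set) \<Rightarrow> bool" where
  "rcomodule H \<Delta> \<epsilon> T \<Delta>T \<longleftrightarrow>
     klinear T (tensor T H) \<Delta>T \<and>
     (\<forall>t\<in>mcar T. tmap (tensor T H) H \<Delta>T id (\<Delta>T t) = assoc_inv T H H (tmap T (tensor H H) id \<Delta> (\<Delta>T t))) \<and>
     (\<forall>t\<in>mcar T. tlift T (\<lambda>s h. msmul T (\<epsilon> h) s) (\<Delta>T t) = t)"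

definition tact :: "('k::field,'t,'c) kmod_scheme \<Rightarrow> ('k,'h,'d) kalg_scheme \<Rightarrow> ('t \<Rightarrow> 'e \<Rightarrow> 't)
        \<Rightarrow> ('t \<times> 'h \<Rightarrow> 'k) set \<Rightarrow> ('e \<times> 'h \<Rightarrow> 'k) set \<Rightarrow> ('t \<times> 'h \<Rightarrow> 'k) set" where
  "tact T H act X Y =
     tlift (tensor T H) (\<lambda>t h. tlift (tensor T H) (\<lambda>x g. tpure T H (act t x) (mmul H h g)) Y) X"

definition hopf_module :: "('k::field,'h,'c) kalg_scheme \<Rightarrow> ('h \<Rightarrow> ('h \<times> 'h \<Rightarrow> 'k) set) \<Rightarrow> ('h \<Rightarrow> 'k)
        \<Rightarrow> ('k,'e,'d) kalg_scheme \<Rightarrow> ('e \<Rightarrow> ('e \<times> 'h \<Rightarrow> 'k) set)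
        \<Rightarrow> ('k,'t,'f) kmod_scheme \<Rightarrow> ('t \<Rightarrow> 'e \<Rightarrow> 't) \<Rightarrow> ('t \<Rightarrow> ('t \<times> 'h \<Rightarrow> 'k) set) \<Rightarrow> bool" where
  "hopf_module H \<Delta> \<epsilon> E \<Delta>E T act \<Delta>T \<longleftrightarrow>
     rmodule E T act \<and> rcomodule H \<Delta> \<epsilon> T \<Delta>T \<and>
     (\<forall>t\<in>mcar T. \<forall>x\<in>mcar E. \<Delta>T (act t x) = tact T H act (\<Delta>T t) (\<Delta>E x))"

definition mod_units :: "('k,'a,'c) kalg_scheme \<Rightarrow> ('k,'t,'d) kmod_scheme \<Rightarrow> ('t \<Rightarrow> 'a \<Rightarrow> 't) \<Rightarrow> 't set" where
  "mod_units A T act = {u \<in> mcar T. bij_betw (\<lambda>x. act u x) (mcar A) (mcar T)}"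

definition torsor_points :: "('k::field,'h,'c) kalg_scheme \<Rightarrow> ('k,'e,'d) kalg_scheme
        \<Rightarrow> ('k,'t,'f) kmod_scheme \<Rightarrow> ('t \<Rightarrow> 'e \<Rightarrow> 't) \<Rightarrow> ('t \<Rightarrow> ('t \<times> 'h \<Rightarrow> 'k) set) \<Rightarrow> 't set" where
  "torsor_points H E T act \<Delta>T =
     {u \<in> mod_units E T act. \<Delta>T u \<in> mod_units (tensor_alg E H) (tensor T H) (tact T H act)}"

definition hopf_torsor :: "('k::field,'h,'c) kalg_scheme \<Rightarrow> ('h \<Rightarrow> ('h \<times> 'h \<Rightarrow> 'k) set) \<Rightarrow> ('h \<Rightarrow> 'k)
        \<Rightarrow> ('k,'e,'d) kalg_scheme \<Rightarrow> ('e \<Rightarrow> ('e \<times> 'h \<Rightarrow> 'k) set)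
        \<Rightarrow> ('k,'t,'f) kmod_scheme \<Rightarrow> ('t \<Rightarrow> 'e \<Rightarrow> 't) \<Rightarrow> ('t \<Rightarrow> ('t \<times> 'h \<Rightarrow> 'k) set) \<Rightarrow> bool" where
  "hopf_torsor H \<Delta> \<epsilon> E \<Delta>E T act \<Delta>T \<longleftrightarrow>
     hopf_module H \<Delta> \<epsilon> E \<Delta>E T act \<Delta>T \<and> torsor_points H E T act \<Delta>T \<noteq> {}"

definition hm_iso :: "('k::field,'h,'c) kalg_scheme \<Rightarrow> ('k,'e,'d) kalg_scheme
        \<Rightarrow> ('k,'t,'f) kmod_scheme \<Rightarrow> ('t \<Rightarrow> 'e \<Rightarrow> 't) \<Rightarrow> ('t \<Rightarrow> ('t \<times> 'h \<Rightarrow> 'k) set)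
        \<Rightarrow> ('k,'s,'g) kmod_scheme \<Rightarrow> ('s \<Rightarrow> 'e \<Rightarrow> 's) \<Rightarrow> ('s \<Rightarrow> ('s \<times> 'h \<Rightarrow> 'k) set) \<Rightarrow> bool" where
  "hm_iso H E T act \<Delta>T T' act' \<Delta>T' \<longleftrightarrow>
     (\<exists>\<phi>. bij_betw \<phi> (mcar T) (mcar T') \<and> klinear T T' \<phi> \<and>
        (\<forall>t\<in>mcar T. \<forall>x\<in>mcar E. \<phi> (act t x) = act' (\<phi> t) x) \<and>
        (\<forall>t\<in>mcar T. \<Delta>T' (\<phi> t) = tmap T' H \<phi> id (\<Delta>T t)))"

definition cd0 :: "('k::field,'e,'c) kalg_scheme \<Rightarrow> ('k,'h,'d) kalg_scheme \<Rightarrow> ('e \<Rightarrow> ('e \<times> 'h \<Rightarrow> 'k) set)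
        \<Rightarrow> ('e \<times> 'h \<Rightarrow> 'k) set \<Rightarrow> ((('e \<times> 'h \<Rightarrow> 'k) set) \<times> 'h \<Rightarrow> 'k) set" where
  "cd0 E H \<Delta>E X = tmap (tensor E H) H \<Delta>E id X"

definition cd1 :: "('k::field,'e,'c) kalg_scheme \<Rightarrow> ('k,'h,'d) kalg_scheme \<Rightarrow> ('h \<Rightarrow> ('h \<times> 'h \<Rightarrow> 'k) set)
        \<Rightarrow> ('e \<times> 'h \<Rightarrow> 'k) set \<Rightarrow> ((('e \<times> 'h \<Rightarrow> 'k) set) \<times> 'h \<Rightarrow> 'k) set" where
  "cd1 E H \<Delta> X = assoc_inv E H H (tmap E (tensor H H) id \<Delta> X)"

definition cd2 :: "('k::field,'e,'c) kalg_scheme \<Rightarrow> ('k,'h,'d) kalg_scheme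
        \<Rightarrow> ('e \<times> 'h \<Rightarrow> 'k) set \<Rightarrow> ((('e \<times> 'h \<Rightarrow> 'k) set) \<times> 'h \<Rightarrow> 'k) set" where
  "cd2 E H X = tpure (tensor E H) H X (mone H)"

definition Z1 :: "('k::field,'h,'c) kalg_scheme \<Rightarrow> ('h \<Rightarrow> ('h \<times> 'h \<Rightarrow> 'k) set)
        \<Rightarrow> ('k,'e,'d) kalg_scheme \<Rightarrow> ('e \<Rightarrow> ('e \<times> 'h \<Rightarrow> 'k) set) \<Rightarrow> ('e \<times> 'h \<Rightarrow> 'k) set set" where
  "Z1 H \<Delta> E \<Delta>E =
     {X \<in> alg_units (tensor_alg E H).
        mmul (tensor_alg (tensor_alg E H) H) (cd2 E H X) (cd0 E H \<Delta>E X) = cd1 E H \<Delta> X}"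

text \<open>X and Y are in the same E^x-orbit: Y = X <- x = d^1(x^-1) X d^0(x) for some unit x
  (here d^1(x) = x (x) 1, d^0(x) = Delta_E(x) on E).\<close>
definition cohomologous :: "('k::field,'h,'c) kalg_scheme \<Rightarrow> ('k,'e,'d) kalg_scheme \<Rightarrow> ('e \<Rightarrow> ('e \<times> 'h \<Rightarrow> 'k) set)
        \<Rightarrow> ('e \<times> 'h \<Rightarrow> 'k) set \<Rightarrow> ('e \<times> 'h \<Rightarrow> 'k) set \<Rightarrow> bool" where
  "cohomologous H E \<Delta>E X Y \<longleftrightarrow>
     (\<exists>x\<in>mcar E. \<exists>xi\<in>mcar E. mmul E x xi = mone E \<and> mmul E xi x = mone E \<and>
        Y = mmul (tensor_alg E H) (mmul (tensor_alg E H) (tpure E H xi (mone H)) X) (\<Delta>E x))"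

definition twist :: "('k::field,'e,'c) kalg_scheme \<Rightarrow> ('k,'h,'d) kalg_scheme \<Rightarrow> ('e \<Rightarrow> ('e \<times> 'h \<Rightarrow> 'k) set)
        \<Rightarrow> ('e \<times> 'h \<Rightarrow> 'k) set \<Rightarrow> 'e \<Rightarrow> ('e \<times> 'h \<Rightarrow> 'k) set" where
  "twist E H \<Delta>E X = (\<lambda>x. mmul (tensor_alg E H) X (\<Delta>E x))"

end

theory Submission
  imports Defs
begin

text \<open>
  For a cocycle \<open>X\<close>, the cocycle identity \<open>(X \<otimes> 1) (\<Delta>E \<otimes> id)(X) = (id \<otimes> \<Delta>)(X)\<close> is exactly
  coassociativity of \<open>x \<mapsto> X \<Delta>E(x)\<close>, counitality follows by applying \<open>id \<otimes> \<epsilon> \<otimes> id\<close> to it, and \<open>1\<close>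
  is a torsor point. An \<open>E\<close>-linear bijection of \<open>E\<close> is left multiplication by a unit \<open>u\<close>, and its
  colinearity, evaluated at \<open>1\<close>, reads \<open>Y \<Delta>E(u) = (u \<otimes> 1) X\<close>. For a torsor \<open>T\<close> with point \<open>u\<close>,
  transporting the coaction along \<open>x \<mapsto> u x\<close> gives \<open>x \<mapsto> X \<Delta>E(x)\<close>, where \<open>X\<close> corresponds to
  \<open>\<Delta>T(u)\<close>. All identities between tensors are checked on pure tensors.
\<close>

text \<open>The algebra is short; what shapes the proof is that tensors are concrete. A tensor is a
  class of finitely supported functions modulo \<open>trels\<close>, and every map out of a tensor
  product is computed by \<open>tlift\<close> from a representative picked by \<open>trep\<close>.
  No such value can be calculated until it is known to be independent of the pick; this is
  \<open>tlift_tclass\<close>. Each structure map then receives two facts, its (bi)linearity and its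
  value on pure tensors, and these carry the later calculations. The second obstacle is bracketing:
  the cocycle identity lives in \<open>(E \<otimes> H) \<otimes> H\<close>, while
  \<open>id \<otimes> \<Delta>\<close> lands in \<open>E \<otimes> (H \<otimes> H)\<close>. Hence
  \<open>cd1\<close> contains \<open>assoc_inv\<close>, and the map \<open>assoc_inv\<close> has to
  be shown multiplicative (for coassociativity of the twist) and natural in its first factor (for
  transporting the coaction of a torsor).\<close>

section \<open>Modules on a carrier set, linear and bilinear maps\<close>

lemma kmodule_zero [simp]: "kmodule M \<Longrightarrow> mzero M \<in> mcar M"
  and kmodule_add [simp]: "kmodule M \<Longrightarrow> x \<in> mcar M \<Longrightarrow> y \<in> mcar M \<Longrightarrow> madd M x y \<in> mcar M"
  and kmodule_smul [simp]: "kmodule M \<Longrightarrow> x \<in> mcar M \<Longrightarrow> msmul M c x \<in> mcar M"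
  and kmodule_assoc: "kmodule M \<Longrightarrow> x \<in> mcar M \<Longrightarrow> y \<in> mcar M \<Longrightarrow> z \<in> mcar M
      \<Longrightarrow> madd M (madd M x y) z = madd M x (madd M y z)"
  and kmodule_comm: "kmodule M \<Longrightarrow> x \<in> mcar M \<Longrightarrow> y \<in> mcar M \<Longrightarrow> madd M x y = madd M y x"
  and kmodule_zero_left [simp]: "kmodule M \<Longrightarrow> x \<in> mcar M \<Longrightarrow> madd M (mzero M) x = x"
  and kmodule_neg: "kmodule M \<Longrightarrow> x \<in> mcar M \<Longrightarrow> \<exists>y\<in>mcar M. madd M x y = mzero M"
  and kmodule_smul_smul: "kmodule M \<Longrightarrow> x \<in> mcar M \<Longrightarrow> msmul M (c * d) x = msmul M c (msmul M d x)"
  and kmodule_one_smul [simp]: "kmodule M \<Longrightarrow> x \<in> mcar M \<Longrightarrow> msmul M 1 x = x"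
  and kmodule_smul_distrib: "kmodule M \<Longrightarrow> x \<in> mcar M
      \<Longrightarrow> msmul M (c + d) x = madd M (msmul M c x) (msmul M d x)"
  and kmodule_smul_add: "kmodule M \<Longrightarrow> x \<in> mcar M \<Longrightarrow> y \<in> mcar M
      \<Longrightarrow> msmul M c (madd M x y) = madd M (msmul M c x) (msmul M c y)"
  unfolding kmodule_def by meson+

lemma kmodule_zero_right [simp]:
  assumes "kmodule M" "x \<in> mcar M" shows "madd M x (mzero M) = x"
  using kmodule_comm[OF assms(1) assms(2) kmodule_zero[OF assms(1)]] assms by simp

lemma kmodule_left_comm:
  assumes "kmodule M" "x \<in> mcar M" "y \<in> mcar M" "z \<in> mcar M"
  shows "madd M x (madd M y z) = madd M y (madd M x z)"
  using assms kmodule_assoc[OF assms(1)] kmodule_comm[OF assms(1,2,3)] by metis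

text \<open>Modules carry no negation operation, so cancellation goes through the existential
  inverse. It yields \<open>0 x = 0\<close>, and later the vanishing of a difference whose two terms
  have equal image.\<close>

lemma kmodule_add_eq_imp_zero:
  assumes M: "kmodule M" and x: "x \<in> mcar M" and y: "y \<in> mcar M" and e: "madd M x y = y"
  shows "x = mzero M"
proof -
  obtain z where z: "z \<in> mcar M" "madd M y z = mzero M"
    using kmodule_neg[OF M y] by blast
  have "x = madd M x (madd M y z)" using z M x by simp
  also have "\<dots> = madd M (madd M x y) z" using kmodule_assoc[OF M x y z(1)] by simp
  finally show ?thesis using e z by simp
qed

lemma kmodule_zero_smul [simp]:
  assumes M: "kmodule M" and x: "x \<in> mcar M" shows "msmul M 0 x = mzero M"
  using kmodule_add_eq_imp_zero[OF M, of "msmul M 0 x" "msmul M 0 x"]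
    kmodule_smul_distrib[OF M x, of 0 0] M x by simp

lemma kmodule_smul_zero [simp]:
  assumes M: "kmodule M" shows "msmul M c (mzero M) = mzero M"
  using kmodule_smul_smul[OF M kmodule_zero[OF M], of c 0] M by simp

lemma klinear_closed: "klinear M N f \<Longrightarrow> x \<in> mcar M \<Longrightarrow> f x \<in> mcar N"
  and klinear_add: "klinear M N f \<Longrightarrow> x \<in> mcar M \<Longrightarrow> y \<in> mcar M \<Longrightarrow> f (madd M x y) = madd N (f x) (f y)"
  and klinear_smul: "klinear M N f \<Longrightarrow> x \<in> mcar M \<Longrightarrow> f (msmul M c x) = msmul N c (f x)"
  unfolding klinear_def by blast+

lemma klinear_zero:
  assumes "kmodule M" "kmodule N" "klinear M N f" shows "f (mzero M) = mzero N"
proof -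
  have "f (mzero M) = f (msmul M 0 (mzero M))" using assms(1) by simp
  also have "\<dots> = mzero N"
    using klinear_smul[OF assms(3), of "mzero M" 0] klinear_closed[OF assms(3)] assms by simp
  finally show ?thesis .
qed

lemma klinear_id [simp]: "klinear M M id" "klinear M M (\<lambda>x. x)"
  by (auto simp: klinear_def)

lemma klinear_compose:
  assumes "klinear M N f" "klinear N P g" shows "klinear M P (\<lambda>x. g (f x))"
  using assms unfolding klinear_def by simp

text \<open>Maps are total functions whose values off the carrier are arbitrary, so two expressions
  for the same linear map need not be equal as functions.\<close>

lemma klinear_cong:
  assumes "kmodule M" "klinear M N f" "\<And>x. x \<in> mcar M \<Longrightarrow> f x = g x" shows "klinear M N g"
  using assms by (auto simp: klinear_def)

lemma klinear_pointwise_add: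
  assumes P: "kmodule P" and f: "klinear M P f" and g: "klinear M P g"
  shows "klinear M P (\<lambda>x. madd P (f x) (g x))"
  using f g P unfolding klinear_def
  by (simp add: kmodule_smul_add kmodule_assoc kmodule_left_comm)

lemma klinear_pointwise_smul:
  fixes P :: "('k::field,'p,'c) kmod_scheme"
  assumes P: "kmodule P" and f: "klinear M P f"
  shows "klinear M P (\<lambda>x. msmul P c (f x))"
  using f P unfolding klinear_def
  by (simp add: kmodule_smul_add kmodule_smul_smul[symmetric] mult.commute)

definition kbilinear ::
  "('k::field,'a,'c) kmod_scheme \<Rightarrow> ('k,'b,'d) kmod_scheme \<Rightarrow> ('k,'p,'e) kmod_scheme \<Rightarrow> ('a \<Rightarrow> 'b \<Rightarrow> 'p) \<Rightarrow> bool"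
  where "kbilinear M N P \<beta> \<longleftrightarrow>
    (\<forall>a\<in>mcar M. klinear N P (\<beta> a)) \<and> (\<forall>b\<in>mcar N. klinear M P (\<lambda>a. \<beta> a b))"

lemma kbilinearI:
  assumes "\<And>a. a \<in> mcar M \<Longrightarrow> klinear N P (\<beta> a)" "\<And>b. b \<in> mcar N \<Longrightarrow> klinear M P (\<lambda>a. \<beta> a b)"
  shows "kbilinear M N P \<beta>"
  using assms by (simp add: kbilinear_def)

lemma kbilinear_right: "kbilinear M N P \<beta> \<Longrightarrow> a \<in> mcar M \<Longrightarrow> klinear N P (\<beta> a)"
  and kbilinear_left: "kbilinear M N P \<beta> \<Longrightarrow> b \<in> mcar N \<Longrightarrow> klinear M P (\<lambda>a. \<beta> a b)"
  by (simp_all add: kbilinear_def)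

lemma kbilinear_closed: "kbilinear M N P \<beta> \<Longrightarrow> a \<in> mcar M \<Longrightarrow> b \<in> mcar N \<Longrightarrow> \<beta> a b \<in> mcar P"
  using kbilinear_right klinear_closed by metis

text \<open>The shape in which the lemmas on \<open>lincomb\<close> take their hypothesis; they use
  closedness of the values rather than bilinearity.\<close>

lemma kbilinear_closed_ball: "kbilinear M N P \<beta> \<Longrightarrow> \<forall>a\<in>mcar M. \<forall>b\<in>mcar N. \<beta> a b \<in> mcar P"
  unfolding kbilinear_def klinear_def by blast

text \<open>Composition on both inputs and on the output at once; an identity map fills each slot
  that stays unchanged.\<close>

lemma kbilinear_compose:
  assumes "kbilinear M N P \<beta>" "klinear M' M f" "klinear N' N g" "klinear P Q h"
  shows "kbilinear M' N' Q (\<lambda>a b. h (\<beta> (f a) (g b)))"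
proof (rule kbilinearI)
  fix a assume "a \<in> mcar M'"
  then have "klinear N P (\<beta> (f a))" using assms klinear_closed kbilinear_right by metis
  from klinear_compose[OF klinear_compose[OF assms(3) this] assms(4)]
  show "klinear N' Q (\<lambda>b. h (\<beta> (f a) (g b)))" .
next
  fix b assume "b \<in> mcar N'"
  then have "klinear M P (\<lambda>a. \<beta> a (g b))" using assms klinear_closed kbilinear_left by metis
  from klinear_compose[OF klinear_compose[OF assms(2) this] assms(4)]
  show "klinear M' Q (\<lambda>a. h (\<beta> (f a) (g b)))" .
qed

section \<open>Finite sums and linear combinations\<close>

text \<open>Addition is only commutative on the carrier, so the fold is compared with the fold of a
  map that is extended by the identity outside the carrier.\<close>

lemma msum_eq_guarded_fold:
  assumes P: "kmodule P" and A: "finite A" "g ` A \<subseteq> mcar P"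
  shows "msum P g A = Finite_Set.fold
    (\<lambda>x acc. if g x \<in> mcar P \<and> acc \<in> mcar P then madd P (g x) acc else acc) (mzero P) A"
    (is "_ = Finite_Set.fold ?F _ _")
proof -
  have 1: "fold_graph ?F (mzero P) B y \<and> y \<in> mcar P"
    if "fold_graph (\<lambda>x acc. madd P (g x) acc) (mzero P) B y" "g ` B \<subseteq> mcar P" for B y
    using that
  proof (induction)
    case emptyI then show ?case using P by (simp add: fold_graph.emptyI)
  next
    case (insertI x B y)
    then have "fold_graph ?F (mzero P) (insert x B) (?F x y)"
      by (intro fold_graph.insertI) auto
    with insertI P show ?case by simp
  qed
  have 2: "fold_graph (\<lambda>x acc. madd P (g x) acc) (mzero P) B y \<and> y \<in> mcar P"
    if "fold_graph ?F (mzero P) B y" "g ` B \<subseteq> mcar P" for B y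
    using that
  proof (induction)
    case emptyI then show ?case using P by (simp add: fold_graph.emptyI)
  next
    case (insertI x B y)
    then have "fold_graph (\<lambda>x acc. madd P (g x) acc) (mzero P) (insert x B) (madd P (g x) y)"
      by (intro fold_graph.insertI) auto
    with insertI P show ?case by simp
  qed
  \<comment> \<open>\<open>Finite_Set.fold\<close> depends on its step map only through
    \<open>fold_graph\<close>, so equal graphs give equal folds. The graphs agree because every
    accumulator reached from \<open>mzero P\<close> stays in the carrier.\<close>
  have "fold_graph (\<lambda>x acc. madd P (g x) acc) (mzero P) A = fold_graph ?F (mzero P) A"
    using 1 2 A by (intro ext) blast
  then show ?thesis by (simp add: msum_def Finite_Set.fold_def)
qed

lemma msum_empty [simp]: "msum P g {} = mzero P"
  by (simp add: msum_def)

lemma msum_insert_closed: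
  assumes P: "kmodule P" and A: "finite A" "x \<notin> A" "g ` insert x A \<subseteq> mcar P"
  shows "msum P g (insert x A) = madd P (g x) (msum P g A) \<and> msum P g A \<in> mcar P"
proof -
  let ?F = "\<lambda>x acc. if g x \<in> mcar P \<and> acc \<in> mcar P then madd P (g x) acc else acc"
  \<comment> \<open>The locale asks for commutation at all arguments; where the guard fails the step
    does nothing, so commutativity on the carrier suffices.\<close>
  interpret comp_fun_commute ?F
    by standard (auto simp: fun_eq_iff P kmodule_left_comm)
  have "finite B \<Longrightarrow> Finite_Set.fold ?F (mzero P) B \<in> mcar P" for B
    by (induction rule: finite_induct) (auto simp: P)
  then show ?thesis
    using A by (simp add: msum_eq_guarded_fold[OF P])
qed

lemma msum_insert:
  assumes "kmodule P" "finite A" "x \<notin> A" "g ` insert x A \<subseteq> mcar P"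
  shows "msum P g (insert x A) = madd P (g x) (msum P g A)"
  using msum_insert_closed[OF assms] by blast

lemma msum_closed:
  assumes P: "kmodule P" and "finite A" "g ` A \<subseteq> mcar P"
  shows "msum P g A \<in> mcar P"
  using assms(2,3) by (induction rule: finite_induct) (auto simp: P msum_insert)

lemma msum_cong:
  assumes P: "kmodule P" and "finite A" "g ` A \<subseteq> mcar P" "\<And>x. x \<in> A \<Longrightarrow> g x = h x"
  shows "msum P g A = msum P h A"
  using assms(2-)
proof (induction rule: finite_induct)
  case (insert x A)
  then have "h ` insert x A \<subseteq> mcar P" by auto
  with insert show ?case by (simp add: msum_insert P)
qed simp

lemma msum_add:
  assumes P: "kmodule P" and "finite A" "g ` A \<subseteq> mcar P" "h ` A \<subseteq> mcar P"
  shows "msum P (\<lambda>x. madd P (g x) (h x)) A = madd P (msum P g A) (msum P h A)"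
  using assms(2-)
proof (induction rule: finite_induct)
  case (insert x A)
  then have "(\<lambda>x. madd P (g x) (h x)) ` insert x A \<subseteq> mcar P" using P by (auto simp: image_subset_iff)
  with insert show ?case
    by (simp add: msum_insert P msum_closed kmodule_assoc kmodule_left_comm)
qed (simp add: P)

lemma msum_smul:
  assumes P: "kmodule P" and "finite A" "g ` A \<subseteq> mcar P"
  shows "msum P (\<lambda>x. msmul P c (g x)) A = msmul P c (msum P g A)"
  using assms(2-)
proof (induction rule: finite_induct)
  case (insert x A)
  then have "(\<lambda>x. msmul P c (g x)) ` insert x A \<subseteq> mcar P" using P by (auto simp: image_subset_iff)
  with insert show ?case
    by (simp add: msum_insert P msum_closed kmodule_smul_add)
qed (simp add: P)

lemma msum_mono_neutral:
  assumes P: "kmodule P" and "finite B" "A \<subseteq> B" "g ` A \<subseteq> mcar P" "\<And>x. x \<in> B - A \<Longrightarrow> g x = mzero P"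
  shows "msum P g B = msum P g A"
proof -
  have fA: "finite A" using assms finite_subset by blast
  have "finite C \<Longrightarrow> C \<inter> A = {} \<Longrightarrow> (\<And>x. x \<in> C \<Longrightarrow> g x = mzero P)
      \<Longrightarrow> msum P g (C \<union> A) = msum P g A" for C
  proof (induction rule: finite_induct)
    case (insert x C)
    have "g ` insert x (C \<union> A) \<subseteq> mcar P" using insert assms(4) P by auto
    with insert fA show ?case
      by (simp add: msum_insert P msum_closed assms(4))
  qed simp
  from this[of "B - A"] assms(2,3,5) show ?thesis
    by (simp add: Un_absorb2 Int_commute)
qed

text \<open>The value of \<open>tlift\<close> computed from a given function instead of the one
  chosen by \<open>trep\<close>. This separates evaluation from the choice of a
  representative.\<close>

definition lincomb :: "('k::field,'p,'c) kmod_scheme \<Rightarrow> ('a \<Rightarrow> 'b \<Rightarrow> 'p) \<Rightarrow> ('a \<times> 'b \<Rightarrow> 'k) \<Rightarrow> 'p" where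
  "lincomb P \<beta> f = msum P (\<lambda>p. msmul P (f p) (\<beta> (fst p) (snd p))) (tsupp f)"

lemma tlift_eq_lincomb: "tlift P \<beta> X = lincomb P \<beta> (trep X)"
  by (simp add: tlift_def lincomb_def)

lemma tfree_tsupp: "f \<in> tfree M N \<longleftrightarrow> finite (tsupp f) \<and> tsupp f \<subseteq> mcar M \<times> mcar N"
  by (simp add: tfree_def tsupp_def)

lemma tfree_zero [simp]: "(\<lambda>_. 0) \<in> tfree M N"
  by (simp add: tfree_def)

lemma tfree_lin:
  assumes "f \<in> tfree M N" "g \<in> tfree M N" shows "(\<lambda>p. c * f p + g p) \<in> tfree M N"
proof -
  have "tsupp (\<lambda>p. c * f p + g p) \<subseteq> tsupp f \<union> tsupp g" by (auto simp: tsupp_def)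
  with assms finite_subset show ?thesis unfolding tfree_tsupp by blast
qed

lemma tfree_add [simp]: "f \<in> tfree M N \<Longrightarrow> g \<in> tfree M N \<Longrightarrow> (\<lambda>p. f p + g p) \<in> tfree M N"
  using tfree_lin[of f M N g 1] by simp

lemma tfree_smul [simp]: "f \<in> tfree M N \<Longrightarrow> (\<lambda>p. c * f p) \<in> tfree M N"
  using tfree_lin[of f M N "\<lambda>_. 0" c] by simp

lemma tfree_diff [simp]: "f \<in> tfree M N \<Longrightarrow> g \<in> tfree M N \<Longrightarrow> (\<lambda>p. f p - g p) \<in> tfree M N"
  using tfree_lin[of g M N f "-1"] by simp

lemma tfree_tdelta [simp]: "a \<in> mcar M \<Longrightarrow> b \<in> mcar N \<Longrightarrow> tdelta a b \<in> tfree M N"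
  by (auto simp: tfree_def tdelta_def)

context
  fixes M :: "('k::field,'a,'c) kmod_scheme" and N :: "('k,'b,'d) kmod_scheme"
    and P :: "('k,'p,'e) kmod_scheme" and \<beta> :: "'a \<Rightarrow> 'b \<Rightarrow> 'p"
  assumes P: "kmodule P"
    and \<beta>: "\<forall>a\<in>mcar M. \<forall>b\<in>mcar N. \<beta> a b \<in> mcar P"
begin

text \<open>Cancellation makes the supports of \<open>f\<close>, \<open>g\<close> and their sum
  differ; all three combinations can be compared once they are summed over one finite set.\<close>

lemma lincomb_superset:
  assumes "finite B" "tsupp f \<subseteq> B" "B \<subseteq> mcar M \<times> mcar N"
  shows "lincomb P \<beta> f = msum P (\<lambda>p. msmul P (f p) (\<beta> (fst p) (snd p))) B"
  unfolding lincomb_def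
proof (rule msum_mono_neutral[symmetric])
  show "(\<lambda>p. msmul P (f p) (\<beta> (fst p) (snd p))) ` tsupp f \<subseteq> mcar P"
    using assms P \<beta> by fastforce
  show "msmul P (f p) (\<beta> (fst p) (snd p)) = mzero P" if "p \<in> B - tsupp f" for p
    using that assms P \<beta> by (force simp: tsupp_def)
qed (use assms P in auto)

lemma lincomb_closed: "f \<in> tfree M N \<Longrightarrow> lincomb P \<beta> f \<in> mcar P"
  unfolding lincomb_def tfree_tsupp by (rule msum_closed) (use P \<beta> in fastforce)+

lemma lincomb_add:
  assumes "f \<in> tfree M N" "g \<in> tfree M N"
  shows "lincomb P \<beta> (\<lambda>p. f p + g p) = madd P (lincomb P \<beta> f) (lincomb P \<beta> g)"
proof -
  let ?B = "tsupp f \<union> tsupp g"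
  have B: "finite ?B" "?B \<subseteq> mcar M \<times> mcar N" "tsupp (\<lambda>p. f p + g p) \<subseteq> ?B"
    using assms by (auto simp: tfree_tsupp tsupp_def)
  have *: "(\<lambda>p. msmul P (h p) (\<beta> (fst p) (snd p))) ` ?B \<subseteq> mcar P" for h
    using B P \<beta> by fastforce
  have "msum P (\<lambda>p. msmul P (f p + g p) (\<beta> (fst p) (snd p))) ?B =
      msum P (\<lambda>p. madd P (msmul P (f p) (\<beta> (fst p) (snd p))) (msmul P (g p) (\<beta> (fst p) (snd p)))) ?B"
  proof (rule msum_cong[OF P B(1) *])
    fix p assume "p \<in> ?B"
    then have "\<beta> (fst p) (snd p) \<in> mcar P" using B \<beta> by fastforce
    then show "msmul P (f p + g p) (\<beta> (fst p) (snd p)) =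
        madd P (msmul P (f p) (\<beta> (fst p) (snd p))) (msmul P (g p) (\<beta> (fst p) (snd p)))"
      by (rule kmodule_smul_distrib[OF P])
  qed
  then show ?thesis
    using lincomb_superset[OF B(1) B(3) B(2)] lincomb_superset[OF B(1) _ B(2), of f]
      lincomb_superset[OF B(1) _ B(2), of g] msum_add[OF P B(1) * *] by simp
qed

lemma lincomb_smul:
  assumes "f \<in> tfree M N"
  shows "lincomb P \<beta> (\<lambda>p. c * f p) = msmul P c (lincomb P \<beta> f)"
proof -
  have B: "finite (tsupp f)" "tsupp f \<subseteq> mcar M \<times> mcar N" "tsupp (\<lambda>p. c * f p) \<subseteq> tsupp f"
    using assms by (auto simp: tfree_tsupp tsupp_def)
  have *: "(\<lambda>p. msmul P (h p) (\<beta> (fst p) (snd p))) ` tsupp f \<subseteq> mcar P" for h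
    using B P \<beta> by fastforce
  have "msum P (\<lambda>p. msmul P (c * f p) (\<beta> (fst p) (snd p))) (tsupp f) =
      msum P (\<lambda>p. msmul P c (msmul P (f p) (\<beta> (fst p) (snd p)))) (tsupp f)"
  proof (rule msum_cong[OF P B(1) *])
    fix p assume "p \<in> tsupp f"
    then have "\<beta> (fst p) (snd p) \<in> mcar P" using B \<beta> by fastforce
    then show "msmul P (c * f p) (\<beta> (fst p) (snd p)) = msmul P c (msmul P (f p) (\<beta> (fst p) (snd p)))"
      by (rule kmodule_smul_smul[OF P])
  qed
  then show ?thesis
    using lincomb_superset[OF B(1) B(3) B(2)] msum_smul[OF P B(1) *]
    by (simp add: lincomb_def)
qed

lemma lincomb_tdelta:
  assumes "a \<in> mcar M" "b \<in> mcar N" shows "lincomb P \<beta> (tdelta a b) = \<beta> a b"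
proof -
  have "tsupp (tdelta a b :: _ \<Rightarrow> 'k) = {(a, b)}" by (auto simp: tsupp_def tdelta_def)
  with assms P \<beta> show ?thesis
    by (simp add: lincomb_def msum_insert tdelta_def)
qed

lemma lincomb_zero: "lincomb P \<beta> (\<lambda>_. 0) = mzero P"
  by (simp add: lincomb_def tsupp_def)

end

section \<open>The universal property of the tensor product\<close>

lemma trels_tfree:
  assumes "kmodule M" "kmodule N" "r \<in> trels M N" shows "r \<in> tfree M N"
  using assms unfolding trels_def by (elim UnE) auto

lemma kspan_add: "s \<in> kspan R \<Longrightarrow> t \<in> kspan R \<Longrightarrow> (\<lambda>p. s p + t p) \<in> kspan R"
proof (induction rule: kspan.induct)
  case (kspan_step s u c)
  from kspan.kspan_step[OF kspan_step(1) kspan_step(3)[OF kspan_step(4)], of c]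
  show ?case by (simp add: add.assoc)
qed simp

lemma kspan_smul: "s \<in> kspan R \<Longrightarrow> (\<lambda>p. c * s p) \<in> kspan R"
proof (induction rule: kspan.induct)
  case kspan_zero then show ?case by (simp add: kspan.kspan_zero)
next
  case (kspan_step s u d)
  from kspan.kspan_step[OF kspan_step(1) kspan_step(3), of "c * d"]
  show ?case by (simp add: algebra_simps)
qed

lemma kspan_base: "s \<in> R \<Longrightarrow> s \<in> kspan R"
  using kspan.kspan_step[OF _ kspan.kspan_zero, of s R 1] by simp

lemma kspan_diff_commute: "(\<lambda>p. f p - g p) \<in> kspan R \<Longrightarrow> (\<lambda>p. g p - f p) \<in> kspan R"
  using kspan_smul[of "\<lambda>p. f p - g p" R "-1"] by simp

lemma kspan_diff_trans:
  "(\<lambda>p. f p - g p) \<in> kspan R \<Longrightarrow> (\<lambda>p. g p - h p) \<in> kspan R \<Longrightarrow> (\<lambda>p. f p - h p) \<in> kspan R"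
  using kspan_add[of "\<lambda>p. f p - g p" R "\<lambda>p. g p - h p"] by simp

lemma tclass_eqI:
  assumes "(\<lambda>p. f p - g p) \<in> kspan (trels M N)" shows "tclass M N f = tclass M N g"
  unfolding tclass_def
  using kspan_diff_trans[OF assms] kspan_diff_trans[OF kspan_diff_commute[OF assms]] by blast

text \<open>A function in \<open>tfree\<close> belongs to its own class, so the choice is made from
  a nonempty set. These two facts are what later proofs know about the chosen
  representative.\<close>

lemma trep_tclass:
  assumes "f \<in> tfree M N"
  shows "trep (tclass M N f) \<in> tfree M N"
    and "(\<lambda>p. f p - trep (tclass M N f) p) \<in> kspan (trels M N)"
proof -
  have "f \<in> tclass M N f" using assms by (simp add: tclass_def kspan.kspan_zero)
  then have "trep (tclass M N f) \<in> tclass M N f" unfolding trep_def by (rule someI[of "\<lambda>g. g \<in> tclass M N f"])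
  then show "trep (tclass M N f) \<in> tfree M N"
    "(\<lambda>p. f p - trep (tclass M N f) p) \<in> kspan (trels M N)"
    by (simp_all add: tclass_def)
qed

lemma mcar_tensor: "mcar (tensor M N) = tclass M N ` tfree M N"
  by (simp add: tensor_def tcar_def)

lemma mzero_tensor: "mzero (tensor M N) = tclass M N (\<lambda>_. 0)"
  by (simp add: tensor_def)

lemma madd_tensor:
  assumes "f \<in> tfree M N" "g \<in> tfree M N"
  shows "madd (tensor M N) (tclass M N f) (tclass M N g) = tclass M N (\<lambda>p. f p + g p)"
proof -
  have "(\<lambda>p. (trep (tclass M N f) p + trep (tclass M N g) p) - (f p + g p)) \<in> kspan (trels M N)"
    using kspan_add[OF kspan_diff_commute[OF trep_tclass(2)[OF assms(1)]]
        kspan_diff_commute[OF trep_tclass(2)[OF assms(2)]]] by (simp add: algebra_simps)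
  then show ?thesis by (simp add: tensor_def tclass_eqI)
qed

lemma msmul_tensor:
  assumes "f \<in> tfree M N"
  shows "msmul (tensor M N) c (tclass M N f) = tclass M N (\<lambda>p. c * f p)"
proof -
  have "(\<lambda>p. c * trep (tclass M N f) p - c * f p) \<in> kspan (trels M N)"
    using kspan_smul[OF kspan_diff_commute[OF trep_tclass(2)[OF assms]], of c]
    by (simp add: algebra_simps)
  then show ?thesis by (simp add: tensor_def tclass_eqI)
qed

text \<open>The axioms hold pointwise for functions and descend to classes; the additive inverse is
  the class of the negated function.\<close>

lemma kmodule_tensor [simp]: "kmodule (tensor M N)"
proof -
  have neg: "\<exists>g\<in>tfree M N. tclass M N (\<lambda>p. f p + g p) = tclass M N (\<lambda>_. 0)"
    if "f \<in> tfree M N" for f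
    by (rule bexI[of _ "\<lambda>p. (-1) * f p"]) (use that in simp, rule tfree_smul[OF that])
  show ?thesis
    unfolding kmodule_def
    by (auto simp: mcar_tensor mzero_tensor madd_tensor msmul_tensor algebra_simps neg)
qed

lemma tpure_closed [simp]:
  "a \<in> mcar M \<Longrightarrow> b \<in> mcar N \<Longrightarrow> tpure M N a b \<in> mcar (tensor M N)"
  by (simp add: tpure_def mcar_tensor)

text \<open>The four families in \<open>trels\<close> are exactly the four laws of
  bilinearity.\<close>

lemma kbilinear_tpure:
  assumes M: "kmodule M" and N: "kmodule N" shows "kbilinear M N (tensor M N) (tpure M N)"
proof (rule kbilinearI)
  fix a assume a: "a \<in> mcar M"
  have "tclass M N (tdelta a (madd N x y)) = tclass M N (\<lambda>p. tdelta a x p + tdelta a y p)"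
    if "x \<in> mcar N" "y \<in> mcar N" for x y
    by (intro tclass_eqI kspan_base, unfold trels_def, use a that in \<open>auto simp: diff_diff_eq\<close>)
  moreover have "tclass M N (tdelta a (msmul N c x)) = tclass M N (\<lambda>p. c * tdelta a x p)"
    if "x \<in> mcar N" for x c
    by (intro tclass_eqI kspan_base, unfold trels_def, use a that in auto)
  ultimately show "klinear N (tensor M N) (tpure M N a)"
    using a by (simp add: klinear_def) (simp add: tpure_def madd_tensor msmul_tensor)
next
  fix b assume b: "b \<in> mcar N"
  have "tclass M N (tdelta (madd M x y) b) = tclass M N (\<lambda>p. tdelta x b p + tdelta y b p)"
    if "x \<in> mcar M" "y \<in> mcar M" for x y
    by (intro tclass_eqI kspan_base, unfold trels_def, use b that in \<open>auto simp: diff_diff_eq\<close>)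
  moreover have "tclass M N (tdelta (msmul M c x) b) = tclass M N (\<lambda>p. c * tdelta x b p)"
    if "x \<in> mcar M" for x c
    by (intro tclass_eqI kspan_base, unfold trels_def, use b that in auto)
  ultimately show "klinear M (tensor M N) (\<lambda>a. tpure M N a b)"
    using b by (simp add: klinear_def) (simp add: tpure_def madd_tensor msmul_tensor)
qed

text \<open>Induction on the support of a representative: erasing one support point \<open>p\<close>
  from \<open>f\<close> leaves \<open>g\<close>, and \<open>f\<close> is \<open>f p\<close> times
  the point mass at \<open>p\<close> plus \<open>g\<close>.\<close>

lemma tensor_induct [consumes 1, case_names zero step]:
  assumes X: "X \<in> mcar (tensor M N)"
    and zero: "Q (mzero (tensor M N))"
    and step: "\<And>c a b X. a \<in> mcar M \<Longrightarrow> b \<in> mcar N \<Longrightarrow> X \<in> mcar (tensor M N) \<Longrightarrow> Q X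
      \<Longrightarrow> Q (madd (tensor M N) (msmul (tensor M N) c (tpure M N a b)) X)"
  shows "Q X"
proof -
  have "finite A \<Longrightarrow> f \<in> tfree M N \<Longrightarrow> tsupp f = A \<Longrightarrow> Q (tclass M N f)" for f A
  proof (induction A arbitrary: f rule: finite_induct)
    case empty
    then have "f = (\<lambda>_. 0)" by (auto simp: tsupp_def)
    with zero show ?case by (simp add: mzero_tensor)
  next
    case (insert p A)
    obtain a b where p: "p = (a, b)" by (cases p)
    have ab: "a \<in> mcar M" "b \<in> mcar N" using insert.prems p by (auto simp: tfree_tsupp)
    define g where "g = f(p := 0)"
    have tg: "tsupp g = A" using insert.prems insert.hyps by (auto simp: tsupp_def g_def)
    have g: "g \<in> tfree M N" using insert.prems insert.hyps tg by (auto simp: tfree_tsupp)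
    have "f = (\<lambda>q. f p * tdelta a b q + g q)" by (auto simp: g_def tdelta_def p)
    then have "tclass M N f = madd (tensor M N) (msmul (tensor M N) (f p) (tpure M N a b)) (tclass M N g)"
      using ab g by (simp add: tpure_def madd_tensor msmul_tensor)
    moreover have "tclass M N g \<in> mcar (tensor M N)" using g by (simp add: mcar_tensor)
    ultimately show ?case using step[OF ab] insert.IH[OF g tg] by simp
  qed
  with X show ?thesis by (auto simp: mcar_tensor tfree_tsupp)
qed

lemma tensor_ext:
  assumes P: "kmodule P" and f: "klinear (tensor M N) P f" and g: "klinear (tensor M N) P g"
    and eq: "\<And>a b. a \<in> mcar M \<Longrightarrow> b \<in> mcar N \<Longrightarrow> f (tpure M N a b) = g (tpure M N a b)"
    and X: "X \<in> mcar (tensor M N)"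
  shows "f X = g X"
  using X
proof (induction rule: tensor_induct)
  case zero
  show ?case using klinear_zero[OF kmodule_tensor P f] klinear_zero[OF kmodule_tensor P g] by simp
next
  case (step c a b X)
  then show ?case by (simp add: klinear_add[OF f] klinear_smul[OF f] klinear_add[OF g] klinear_smul[OF g] eq)
qed

context
  fixes M :: "('k::field,'a,'c) kmod_scheme" and N :: "('k,'b,'d) kmod_scheme"
    and P :: "('k,'p,'e) kmod_scheme" and \<beta> :: "'a \<Rightarrow> 'b \<Rightarrow> 'p"
  assumes M: "kmodule M" and N: "kmodule N" and P: "kmodule P" and \<beta>: "kbilinear M N P \<beta>"
begin

text \<open>Each generator is a difference \<open>f - g\<close>, and bilinearity of
  \<open>\<beta>\<close> says that \<open>f\<close> and \<open>g\<close> have the same combination;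
  cancelling it leaves zero.\<close>

lemma lincomb_trels: "r \<in> trels M N \<Longrightarrow> lincomb P \<beta> r = mzero P"
proof -
  assume r: "r \<in> trels M N"
  note \<beta>c = kbilinear_closed_ball[OF \<beta>]
  have *: "lincomb P \<beta> r = mzero P"
    if rfg: "r = (\<lambda>p. f p - g p)" and "f \<in> tfree M N" "g \<in> tfree M N" "lincomb P \<beta> f = lincomb P \<beta> g" for f g
  proof (rule kmodule_add_eq_imp_zero[OF P])
    show "madd P (lincomb P \<beta> r) (lincomb P \<beta> g) = lincomb P \<beta> g"
      using lincomb_add[OF P \<beta>c, of r g] that by simp
  qed (use that in \<open>auto intro!: lincomb_closed[OF P \<beta>c]\<close>)
  note lc = lincomb_add[OF P \<beta>c] lincomb_smul[OF P \<beta>c] lincomb_tdelta[OF P \<beta>c]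
  from r consider
    (1) a a' b where "a \<in> mcar M" "a' \<in> mcar M" "b \<in> mcar N"
      "r = (\<lambda>p. tdelta (madd M a a') b p - (tdelta a b p + tdelta a' b p))"
  | (2) a b b' where "a \<in> mcar M" "b \<in> mcar N" "b' \<in> mcar N"
      "r = (\<lambda>p. tdelta a (madd N b b') p - (tdelta a b p + tdelta a b' p))"
  | (3) c a b where "a \<in> mcar M" "b \<in> mcar N"
      "r = (\<lambda>p. tdelta (msmul M c a) b p - c * tdelta a b p)"
  | (4) c a b where "a \<in> mcar M" "b \<in> mcar N"
      "r = (\<lambda>p. tdelta a (msmul N c b) p - c * tdelta a b p)"
    unfolding trels_def diff_diff_eq by blast
  then show ?thesis
  proof cases
    case 1 then show ?thesis
      by (intro *[OF 1(4)]) (simp_all add: lc M klinear_add[OF kbilinear_left[OF \<beta>]])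
  next
    case 2 then show ?thesis
      by (intro *[OF 2(4)]) (simp_all add: lc N klinear_add[OF kbilinear_right[OF \<beta>]])
  next
    case 3 then show ?thesis
      by (intro *[OF 3(3)]) (simp_all add: lc M klinear_smul[OF kbilinear_left[OF \<beta>]])
  next
    case 4 then show ?thesis
      by (intro *[OF 4(3)]) (simp_all add: lc N klinear_smul[OF kbilinear_right[OF \<beta>]])
  qed
qed

text \<open>Membership in \<open>tfree\<close> is carried through the induction because additivity
  of \<open>lincomb\<close> requires it of the partial sums.\<close>

lemma lincomb_kspan: "s \<in> kspan (trels M N) \<Longrightarrow> s \<in> tfree M N \<and> lincomb P \<beta> s = mzero P"
proof (induction rule: kspan.induct)
  case kspan_zero
  show ?case by (simp add: lincomb_zero[OF P kbilinear_closed_ball[OF \<beta>]])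
next
  case (kspan_step s t c)
  then show ?case
    using trels_tfree[OF M N] lincomb_trels P
    by (simp add: lincomb_add[OF P kbilinear_closed_ball[OF \<beta>]] lincomb_smul[OF P kbilinear_closed_ball[OF \<beta>]])
qed

text \<open>Independence of the representative: \<open>f\<close> is the chosen function plus an
  element of the span of the relations, and the combination kills the latter.\<close>

lemma tlift_tclass:
  assumes f: "f \<in> tfree M N" shows "tlift P \<beta> (tclass M N f) = lincomb P \<beta> f"
proof -
  let ?g = "trep (tclass M N f)"
  have g: "?g \<in> tfree M N" and d: "(\<lambda>p. f p - ?g p) \<in> kspan (trels M N)" using trep_tclass[OF f] .
  have "lincomb P \<beta> (\<lambda>p. (f p - ?g p) + ?g p) = madd P (mzero P) (lincomb P \<beta> ?g)"
    using lincomb_add[OF P kbilinear_closed_ball[OF \<beta>] conjunct1[OF lincomb_kspan[OF d]] g]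
      lincomb_kspan[OF d] by simp
  then show ?thesis
    using lincomb_closed[OF P kbilinear_closed_ball[OF \<beta>] g] P by (simp add: tlift_eq_lincomb)
qed

lemma klinear_tlift: "klinear (tensor M N) P (tlift P \<beta>)"
  unfolding klinear_def
  by (auto simp: mcar_tensor madd_tensor msmul_tensor tlift_tclass
      lincomb_add[OF P kbilinear_closed_ball[OF \<beta>]] lincomb_smul[OF P kbilinear_closed_ball[OF \<beta>]]
      lincomb_closed[OF P kbilinear_closed_ball[OF \<beta>]])

lemma tlift_tpure: "a \<in> mcar M \<Longrightarrow> b \<in> mcar N \<Longrightarrow> tlift P \<beta> (tpure M N a b) = \<beta> a b"
  by (simp add: tpure_def tlift_tclass lincomb_tdelta[OF P kbilinear_closed_ball[OF \<beta>]])

end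

section \<open>Equality and linearity tested on pure tensors\<close>

lemma tensor_ext_kbilinear:
  assumes P: "kmodule P" and F: "kbilinear (tensor M N) (tensor M' N') P F"
    and G: "kbilinear (tensor M N) (tensor M' N') P G"
    and eq: "\<And>a b a' b'. a \<in> mcar M \<Longrightarrow> b \<in> mcar N \<Longrightarrow> a' \<in> mcar M' \<Longrightarrow> b' \<in> mcar N'
      \<Longrightarrow> F (tpure M N a b) (tpure M' N' a' b') = G (tpure M N a b) (tpure M' N' a' b')"
    and X: "X \<in> mcar (tensor M N)" and Y: "Y \<in> mcar (tensor M' N')"
  shows "F X Y = G X Y"
proof (rule tensor_ext[OF P kbilinear_left[OF F Y] kbilinear_left[OF G Y] _ X])
  fix a b assume ab: "a \<in> mcar M" "b \<in> mcar N"
  show "F (tpure M N a b) Y = G (tpure M N a b) Y"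
    by (rule tensor_ext[OF P kbilinear_right[OF F] kbilinear_right[OF G] _ Y]) (simp_all add: ab eq)
qed

text \<open>For right-nested triple products, the domain of \<open>assoc_inv\<close>: one extension
  step for the outer product and one for the inner.\<close>

lemma tensor_ext_right:
  assumes M: "kmodule M" and P: "kmodule P"
    and f: "klinear (tensor M (tensor N Q)) P f" and g: "klinear (tensor M (tensor N Q)) P g"
    and eq: "\<And>a b c. a \<in> mcar M \<Longrightarrow> b \<in> mcar N \<Longrightarrow> c \<in> mcar Q
      \<Longrightarrow> f (tpure M (tensor N Q) a (tpure N Q b c)) = g (tpure M (tensor N Q) a (tpure N Q b c))"
    and X: "X \<in> mcar (tensor M (tensor N Q))"
  shows "f X = g X"
proof (rule tensor_ext[OF P f g _ X])
  fix a Y assume Y: "Y \<in> mcar (tensor N Q)" and a: "a \<in> mcar M"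
  note t = kbilinear_right[OF kbilinear_tpure[OF M kmodule_tensor] a]
  show "f (tpure M (tensor N Q) a Y) = g (tpure M (tensor N Q) a Y)"
    by (rule tensor_ext[OF P klinear_compose[OF t f] klinear_compose[OF t g] _ Y]) (simp add: eq a)
qed

text \<open>For fixed parameters, both sides of each linearity law in \<open>a\<close> are linear in
  \<open>Y\<close>, so the law spreads from pure tensors to all \<open>Y\<close>. This is what makes
  nested lifts possible.\<close>

lemma klinear_parameter:
  assumes M: "kmodule M" and P: "kmodule P"
    and F: "\<And>a. a \<in> mcar M \<Longrightarrow> klinear (tensor M' N') P (F a)"
    and pure: "\<And>a' b'. a' \<in> mcar M' \<Longrightarrow> b' \<in> mcar N' \<Longrightarrow> klinear M P (\<lambda>a. F a (tpure M' N' a' b'))"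
    and Y: "Y \<in> mcar (tensor M' N')"
  shows "klinear M P (\<lambda>a. F a Y)"
  unfolding klinear_def
proof (intro conjI ballI allI)
  fix x assume x: "x \<in> mcar M"
  then show "F x Y \<in> mcar P" using klinear_closed[OF F Y] by blast
  show "F (madd M x y) Y = madd P (F x Y) (F y Y)" if y: "y \<in> mcar M" for y
    by (rule tensor_ext[OF P F klinear_pointwise_add[OF P F F] _ Y])
      (use x y M klinear_add[OF pure] in auto)
  show "F (msmul M c x) Y = msmul P c (F x Y)" for c
    by (rule tensor_ext[OF P F klinear_pointwise_smul[OF P F] _ Y])
      (use x M klinear_smul[OF pure] in auto)
qed

text \<open>Two nested lifts are the common form of the action \<open>tact\<close> and of the
  product in \<open>tensor_alg\<close>. The outer lift is legitimate only if the inner one is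
  bilinear in the outer variables.\<close>

lemma kbilinear_tlift_tlift:
  assumes M: "kmodule M" and N: "kmodule N" and M': "kmodule M'" and N': "kmodule N'" and P: "kmodule P"
    and inner: "\<And>a b. a \<in> mcar M \<Longrightarrow> b \<in> mcar N \<Longrightarrow> kbilinear M' N' P (\<mu> a b)"
    and outer: "\<And>a' b'. a' \<in> mcar M' \<Longrightarrow> b' \<in> mcar N' \<Longrightarrow> kbilinear M N P (\<lambda>a b. \<mu> a b a' b')"
  shows "kbilinear (tensor M N) (tensor M' N') P (\<lambda>X Y. tlift P (\<lambda>a b. tlift P (\<mu> a b) Y) X)"
    and "\<lbrakk>a \<in> mcar M; b \<in> mcar N; a' \<in> mcar M'; b' \<in> mcar N'\<rbrakk>
      \<Longrightarrow> tlift P (\<lambda>a b. tlift P (\<mu> a b) (tpure M' N' a' b')) (tpure M N a b) = \<mu> a b a' b'"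
proof -
  have lin: "klinear (tensor M' N') P (tlift P (\<mu> a b))" if "a \<in> mcar M" "b \<in> mcar N" for a b
    using klinear_tlift[OF M' N' P inner] that by blast
  have pure: "tlift P (\<mu> a b) (tpure M' N' a' b') = \<mu> a b a' b'"
    if "a \<in> mcar M" "b \<in> mcar N" "a' \<in> mcar M'" "b' \<in> mcar N'" for a b a' b'
    using tlift_tpure[OF M' N' P inner] that by blast
  \<comment> \<open>At a pure \<open>Y\<close> the inner lift is \<open>\<mu>\<close> itself, where
    \<open>outer\<close> applies; \<open>klinear_parameter\<close> extends this to every
    \<open>Y\<close>.\<close>
  have bil: "kbilinear M N P (\<lambda>a b. tlift P (\<mu> a b) Y)" if Y: "Y \<in> mcar (tensor M' N')" for Y
  proof (rule kbilinearI)
    fix a assume a: "a \<in> mcar M"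
    show "klinear N P (\<lambda>b. tlift P (\<mu> a b) Y)"
      by (rule klinear_parameter[OF N P lin[OF a] _ Y])
        (simp, rule klinear_cong[OF N kbilinear_right[OF outer a]], simp_all add: pure a)
  next
    fix b assume b: "b \<in> mcar N"
    show "klinear M P (\<lambda>a. tlift P (\<mu> a b) Y)"
      by (rule klinear_parameter[OF M P lin[OF _ b] _ Y])
        (simp, rule klinear_cong[OF M kbilinear_left[OF outer b]], simp_all add: pure b)
  qed
  show "kbilinear (tensor M N) (tensor M' N') P (\<lambda>X Y. tlift P (\<lambda>a b. tlift P (\<mu> a b) Y) X)"
  proof (rule kbilinearI)
    fix X assume X: "X \<in> mcar (tensor M N)"
    show "klinear (tensor M' N') P (\<lambda>Y. tlift P (\<lambda>a b. tlift P (\<mu> a b) Y) X)"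
    proof (rule klinear_parameter[OF kmodule_tensor P klinear_tlift[OF M N P bil] _ X])
      fix a b assume ab: "a \<in> mcar M" "b \<in> mcar N"
      show "klinear (tensor M' N') P (\<lambda>Y. tlift P (\<lambda>a b. tlift P (\<mu> a b) Y) (tpure M N a b))"
        by (rule klinear_cong[OF kmodule_tensor lin[OF ab]])
          (simp add: tlift_tpure[OF M N P bil] ab)
    qed simp
  next
    fix Y assume "Y \<in> mcar (tensor M' N')"
    then show "klinear (tensor M N) P (\<lambda>X. tlift P (\<lambda>a b. tlift P (\<mu> a b) Y) X)"
      by (intro klinear_tlift[OF M N P bil])
  qed
  show "tlift P (\<lambda>a b. tlift P (\<mu> a b) (tpure M' N' a' b')) (tpure M N a b) = \<mu> a b a' b'"
    if "a \<in> mcar M" "b \<in> mcar N" "a' \<in> mcar M'" "b' \<in> mcar N'"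
    using that by (simp add: tlift_tpure[OF M N P bil] pure)
qed

section \<open>Tensor products of linear maps\<close>

context
  fixes M :: "('k::field,'a,'c) kmod_scheme" and N :: "('k,'b,'d) kmod_scheme"
    and M' :: "('k,'a2,'c2) kmod_scheme" and N' :: "('k,'b2,'d2) kmod_scheme" and f g
  assumes M: "kmodule M" and N: "kmodule N" and M': "kmodule M'" and N': "kmodule N'"
    and f: "klinear M M' f" and g: "klinear N N' g"
begin

lemma kbilinear_tpure_compose: "kbilinear M N (tensor M' N') (\<lambda>a b. tpure M' N' (f a) (g b))"
  by (rule kbilinear_compose[OF kbilinear_tpure[OF M' N'] f g klinear_id(2)])

lemma klinear_tmap: "klinear (tensor M N) (tensor M' N') (tmap M' N' f g)"
  using klinear_tlift[OF M N kmodule_tensor kbilinear_tpure_compose]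
  by (simp add: tmap_def[abs_def])

lemma tmap_tpure: "a \<in> mcar M \<Longrightarrow> b \<in> mcar N \<Longrightarrow> tmap M' N' f g (tpure M N a b) = tpure M' N' (f a) (g b)"
  by (simp add: tmap_def tlift_tpure[OF M N kmodule_tensor kbilinear_tpure_compose])

end

text \<open>\<open>tmap\<close> evaluates its arguments only on carriers, but unfolding it shows
  this only for the chosen representative; comparison on pure tensors avoids that.\<close>

lemma tmap_cong:
  assumes M: "kmodule M" and N: "kmodule N" and M': "kmodule M'" and N': "kmodule N'"
    and f: "klinear M M' f" and f': "klinear M M' f'" and g: "klinear N N' g"
    and eq: "\<And>x. x \<in> mcar M \<Longrightarrow> f x = f' x" and X: "X \<in> mcar (tensor M N)"
  shows "tmap M' N' f g X = tmap M' N' f' g X"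
  by (rule tensor_ext[OF kmodule_tensor klinear_tmap[OF M N M' N' f g] klinear_tmap[OF M N M' N' f' g] _ X])
    (simp add: tmap_tpure[OF M N M' N' f g] tmap_tpure[OF M N M' N' f' g] eq)

section \<open>Reassociation of triple tensor products\<close>

context
  fixes M :: "('k::field,'a,'c) kmod_scheme" and N :: "('k,'b,'d) kmod_scheme"
    and Q :: "('k,'q,'f) kmod_scheme"
  assumes M: "kmodule M" and N: "kmodule N" and Q: "kmodule Q"
begin

lemma kbilinear_reassoc:
  assumes a: "a \<in> mcar M"
  shows "kbilinear N Q (tensor (tensor M N) Q) (\<lambda>b c. tpure (tensor M N) Q (tpure M N a b) c)"
  by (rule kbilinear_compose[OF kbilinear_tpure[OF kmodule_tensor Q]
        kbilinear_right[OF kbilinear_tpure[OF M N] a] klinear_id(2) klinear_id(2)])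

lemma kbilinear_tlift_reassoc:
  "kbilinear M (tensor N Q) (tensor (tensor M N) Q)
     (\<lambda>a y. tlift (tensor (tensor M N) Q) (\<lambda>b c. tpure (tensor M N) Q (tpure M N a b) c) y)"
proof (rule kbilinearI)
  fix y assume y: "y \<in> mcar (tensor N Q)"
  show "klinear M (tensor (tensor M N) Q)
     (\<lambda>a. tlift (tensor (tensor M N) Q) (\<lambda>b c. tpure (tensor M N) Q (tpure M N a b) c) y)"
  proof (rule klinear_parameter[OF M kmodule_tensor klinear_tlift[OF N Q kmodule_tensor kbilinear_reassoc] _ y])
    fix b c assume bc: "b \<in> mcar N" "c \<in> mcar Q"
    from klinear_compose[OF kbilinear_left[OF kbilinear_tpure[OF M N] bc(1)]
        kbilinear_left[OF kbilinear_tpure[OF kmodule_tensor Q] bc(2)]]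
    show "klinear M (tensor (tensor M N) Q) (\<lambda>a. tlift (tensor (tensor M N) Q)
        (\<lambda>b c. tpure (tensor M N) Q (tpure M N a b) c) (tpure N Q b c))"
      by (rule klinear_cong[OF M])
        (simp add: tlift_tpure[OF N Q kmodule_tensor kbilinear_reassoc] bc)
  qed simp
qed (rule klinear_tlift[OF N Q kmodule_tensor kbilinear_reassoc])

lemma klinear_assoc_inv: "klinear (tensor M (tensor N Q)) (tensor (tensor M N) Q) (assoc_inv M N Q)"
  using klinear_tlift[OF M kmodule_tensor kmodule_tensor kbilinear_tlift_reassoc]
  by (simp add: assoc_inv_def[abs_def])

lemma assoc_inv_tpure:
  "a \<in> mcar M \<Longrightarrow> b \<in> mcar N \<Longrightarrow> c \<in> mcar Q
    \<Longrightarrow> assoc_inv M N Q (tpure M (tensor N Q) a (tpure N Q b c)) = tpure (tensor M N) Q (tpure M N a b) c"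
  by (simp add: assoc_inv_def tlift_tpure[OF M kmodule_tensor kmodule_tensor kbilinear_tlift_reassoc]
      tlift_tpure[OF N Q kmodule_tensor kbilinear_reassoc])

end

section \<open>Tensor products of algebras and of modules\<close>

text \<open>The decisive line is \<open>mmul\<close>: the product of \<open>tensor_alg A B\<close>
  is the action \<open>tact\<close> of \<open>A\<close> on itself, so facts about the action of
  \<open>A \<otimes> B\<close> on \<open>T \<otimes> B\<close> cover products as well.\<close>

lemma tensor_alg_sel [simp]:
  "mcar (tensor_alg A B) = mcar (tensor A B)"
  "madd (tensor_alg A B) = madd (tensor A B)"
  "mzero (tensor_alg A B) = mzero (tensor A B)"
  "msmul (tensor_alg A B) = msmul (tensor A B)"
  "mmul (tensor_alg A B) = tact A B (mmul A)"
  "mone (tensor_alg A B) = tpure A B (mone A) (mone B)"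
  by (simp_all add: tensor_alg_def tensor_def tact_def[abs_def])

text \<open>The records of \<open>tensor\<close> and \<open>tensor_alg\<close> have different types
  but the same module part. This rule and its companions below bring iterated products to the
  \<open>tensor\<close> form.\<close>

lemma tclass_tensor_alg [simp]:
  "tclass (tensor_alg A B) C = tclass (tensor A B) C"
  "tclass C (tensor_alg A B) = tclass C (tensor A B)"
  by (simp_all add: tclass_def[abs_def] tfree_def trels_def)

lemma tensor_tensor_alg [simp]:
  "tensor (tensor_alg A B) C = tensor (tensor A B) C"
  "tensor C (tensor_alg A B) = tensor C (tensor A B)"
  by (simp_all add: tensor_def tcar_def tfree_def)

lemma tpure_tensor_alg [simp]:
  "tpure (tensor_alg A B) C = tpure (tensor A B) C"
  "tpure C (tensor_alg A B) = tpure C (tensor A B)"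
  by (simp_all add: tpure_def[abs_def])

lemma tmap_tensor_alg [simp]:
  "tmap (tensor_alg A B) C = tmap (tensor A B) C"
  "tmap C (tensor_alg A B) = tmap C (tensor A B)"
  by (simp_all add: tmap_def[abs_def])

lemma kmodule_tensor_alg [simp]: "kmodule (tensor_alg A B)"
  using kmodule_tensor[of A B] unfolding kmodule_def tensor_alg_sel .

lemma klinear_tensor_alg [simp]:
  "klinear (tensor_alg A B) N f = klinear (tensor A B) N f"
  "klinear N (tensor_alg A B) g = klinear N (tensor A B) g"
  by (simp_all add: klinear_def)

lemma kalgebra_kmodule [simp]: "kalgebra A \<Longrightarrow> kmodule A"
  and kalgebra_one [simp]: "kalgebra A \<Longrightarrow> mone A \<in> mcar A"
  and kalgebra_mul [simp]: "kalgebra A \<Longrightarrow> x \<in> mcar A \<Longrightarrow> y \<in> mcar A \<Longrightarrow> mmul A x y \<in> mcar A"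
  and kalgebra_assoc: "kalgebra A \<Longrightarrow> x \<in> mcar A \<Longrightarrow> y \<in> mcar A \<Longrightarrow> z \<in> mcar A
    \<Longrightarrow> mmul A (mmul A x y) z = mmul A x (mmul A y z)"
  and kalgebra_mul_add: "kalgebra A \<Longrightarrow> x \<in> mcar A \<Longrightarrow> y \<in> mcar A \<Longrightarrow> z \<in> mcar A
    \<Longrightarrow> mmul A x (madd A y z) = madd A (mmul A x y) (mmul A x z)"
  and kalgebra_add_mul: "kalgebra A \<Longrightarrow> x \<in> mcar A \<Longrightarrow> y \<in> mcar A \<Longrightarrow> z \<in> mcar A
    \<Longrightarrow> mmul A (madd A x y) z = madd A (mmul A x z) (mmul A y z)"
  and kalgebra_mul_smul: "kalgebra A \<Longrightarrow> x \<in> mcar A \<Longrightarrow> y \<in> mcar A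
    \<Longrightarrow> mmul A x (msmul A c y) = msmul A c (mmul A x y)"
  and kalgebra_smul_mul: "kalgebra A \<Longrightarrow> x \<in> mcar A \<Longrightarrow> y \<in> mcar A
    \<Longrightarrow> mmul A (msmul A c x) y = msmul A c (mmul A x y)"
  and kalgebra_one_left [simp]: "kalgebra A \<Longrightarrow> x \<in> mcar A \<Longrightarrow> mmul A (mone A) x = x"
  and kalgebra_one_right [simp]: "kalgebra A \<Longrightarrow> x \<in> mcar A \<Longrightarrow> mmul A x (mone A) = x"
  unfolding kalgebra_def by meson+

section \<open>Right modules and the componentwise action\<close>

lemma rmodule_kmodule: "rmodule A T act \<Longrightarrow> kmodule T"
  and rmodule_closed: "rmodule A T act \<Longrightarrow> t \<in> mcar T \<Longrightarrow> x \<in> mcar A \<Longrightarrow> act t x \<in> mcar T"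
  and rmodule_act_mul: "rmodule A T act \<Longrightarrow> t \<in> mcar T \<Longrightarrow> x \<in> mcar A \<Longrightarrow> y \<in> mcar A
    \<Longrightarrow> act t (mmul A x y) = act (act t x) y"
  and rmodule_act_one: "rmodule A T act \<Longrightarrow> t \<in> mcar T \<Longrightarrow> act t (mone A) = t"
  and rmodule_add_act: "rmodule A T act \<Longrightarrow> t \<in> mcar T \<Longrightarrow> t' \<in> mcar T \<Longrightarrow> x \<in> mcar A
    \<Longrightarrow> act (madd T t t') x = madd T (act t x) (act t' x)"
  and rmodule_act_add: "rmodule A T act \<Longrightarrow> t \<in> mcar T \<Longrightarrow> x \<in> mcar A \<Longrightarrow> y \<in> mcar A
    \<Longrightarrow> act t (madd A x y) = madd T (act t x) (act t y)"
  and rmodule_act_smul: "rmodule A T act \<Longrightarrow> t \<in> mcar T \<Longrightarrow> x \<in> mcar A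
    \<Longrightarrow> act t (msmul A c x) = msmul T c (act t x)"
  and rmodule_act_smul_one: "rmodule A T act \<Longrightarrow> t \<in> mcar T \<Longrightarrow> msmul T c t = act t (msmul A c (mone A))"
  unfolding rmodule_def by meson+

lemma kbilinear_mmul: "kalgebra A \<Longrightarrow> kbilinear A A A (mmul A)"
  unfolding kbilinear_def klinear_def
  by (simp add: kalgebra_mul_add kalgebra_add_mul kalgebra_mul_smul kalgebra_smul_mul)

lemma rmodule_mmul: "kalgebra A \<Longrightarrow> rmodule A A (mmul A)"
  unfolding rmodule_def
  by (simp add: kalgebra_assoc kalgebra_mul_add kalgebra_add_mul kalgebra_mul_smul)

text \<open>Homogeneity in \<open>t\<close> comes from \<open>c t = t (c 1)\<close>: then
  \<open>(c t) x = t ((c 1) x) = t (c x) = c (t x)\<close>.\<close>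

lemma kbilinear_act:
  assumes A: "kalgebra A" and T: "rmodule A T act"
  shows "kbilinear T A T act"
proof -
  have "act (msmul T c t) x = msmul T c (act t x)" if t: "t \<in> mcar T" and x: "x \<in> mcar A" for c t x
  proof -
    have "act (msmul T c t) x = act (act t (msmul A c (mone A))) x"
      using rmodule_act_smul_one[OF T t] by simp
    also have "\<dots> = act t (mmul A (msmul A c (mone A)) x)"
      using rmodule_act_mul[OF T t _ x] A by simp
    also have "\<dots> = act t (msmul A c x)"
      using A x klinear_smul[OF kbilinear_left[OF kbilinear_mmul[OF A] x], of "mone A" c] by simp
    finally show ?thesis using rmodule_act_smul[OF T t x] by simp
  qed
  then show ?thesis
    unfolding kbilinear_def klinear_def
    by (simp add: rmodule_closed[OF T] rmodule_add_act[OF T] rmodule_act_add[OF T] rmodule_act_smul[OF T])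
qed

context
  fixes A :: "('k::field,'a,'c) kalg_scheme" and B :: "('k,'b,'d) kalg_scheme"
    and T :: "('k,'t,'e) kmod_scheme" and act
  assumes A: "kalgebra A" and B: "kalgebra B" and T: "rmodule A T act"
begin

lemma kbilinear_tact: "kbilinear (tensor T B) (tensor A B) (tensor T B) (tact T B act)"
  and tact_tpure: "t \<in> mcar T \<Longrightarrow> b \<in> mcar B \<Longrightarrow> a \<in> mcar A \<Longrightarrow> c \<in> mcar B
    \<Longrightarrow> tact T B act (tpure T B t b) (tpure A B a c) = tpure T B (act t a) (mmul B b c)"
proof -
  note Tm = rmodule_kmodule[OF T] and Am = kalgebra_kmodule[OF A] and Bm = kalgebra_kmodule[OF B]
  have i: "kbilinear A B (tensor T B) (\<lambda>a c. tpure T B (act t a) (mmul B b c))"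
    if "t \<in> mcar T" "b \<in> mcar B" for t b
    by (rule kbilinear_tpure_compose[OF Am Bm Tm Bm kbilinear_right[OF kbilinear_act[OF A T] that(1)]
          kbilinear_right[OF kbilinear_mmul[OF B] that(2)]])
  have o: "kbilinear T B (tensor T B) (\<lambda>t b. tpure T B (act t a) (mmul B b c))"
    if "a \<in> mcar A" "c \<in> mcar B" for a c
    by (rule kbilinear_tpure_compose[OF Tm Bm Tm Bm kbilinear_left[OF kbilinear_act[OF A T] that(1)]
          kbilinear_left[OF kbilinear_mmul[OF B] that(2)]])
  show "kbilinear (tensor T B) (tensor A B) (tensor T B) (tact T B act)"
    using kbilinear_tlift_tlift(1)[OF Tm Bm Am Bm kmodule_tensor i o]
    by (simp add: tact_def[abs_def])
  show "tact T B act (tpure T B t b) (tpure A B a c) = tpure T B (act t a) (mmul B b c)"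
    if "t \<in> mcar T" "b \<in> mcar B" "a \<in> mcar A" "c \<in> mcar B"
    unfolding tact_def using kbilinear_tlift_tlift(2)[OF Tm Bm Am Bm kmodule_tensor i o] that by simp
qed

lemma tact_closed [simp]:
  "X \<in> mcar (tensor T B) \<Longrightarrow> Y \<in> mcar (tensor A B) \<Longrightarrow> tact T B act X Y \<in> mcar (tensor T B)"
  by (rule kbilinear_closed[OF kbilinear_tact])

lemma tact_one:
  assumes X: "X \<in> mcar (tensor T B)" shows "tact T B act X (tpure A B (mone A) (mone B)) = X"
  by (rule tensor_ext[OF kmodule_tensor kbilinear_left[OF kbilinear_tact] klinear_id(2) _ X])
    (simp_all add: A B tact_tpure rmodule_act_one[OF T])

end

lemma tact_assoc:
  assumes A: "kalgebra A" and B: "kalgebra B" and T: "rmodule A T act"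
    and X: "X \<in> mcar (tensor T B)" and Y: "Y \<in> mcar (tensor A B)" and Z: "Z \<in> mcar (tensor A B)"
  shows "tact T B act (tact T B act X Y) Z = tact T B act X (tact A B (mmul A) Y Z)"
proof -
  note AA = rmodule_mmul[OF A]
  note bT = kbilinear_tact[OF A B T] and bA = kbilinear_tact[OF A B AA]
  note pT = tact_tpure[OF A B T] and pA = tact_tpure[OF A B AA]
  note cT = tact_closed[OF A B T]
  \<comment> \<open>There are three tensor arguments but extension handles at most two. With
    \<open>Z\<close> pure, both sides are bilinear in \<open>X\<close> and \<open>Y\<close>;
    linearity in \<open>Z\<close> finishes.\<close>
  have pure: "tact T B act (tact T B act X Y) (tpure A B a b) = tact T B act X (tact A B (mmul A) Y (tpure A B a b))"
    if ab: "a \<in> mcar A" "b \<in> mcar B" for a b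
  proof (rule tensor_ext_kbilinear[OF kmodule_tensor _ _ _ X Y])
    have ab': "tpure A B a b \<in> mcar (tensor A B)" using ab by simp
    show "kbilinear (tensor T B) (tensor A B) (tensor T B) (\<lambda>X Y. tact T B act (tact T B act X Y) (tpure A B a b))"
      by (rule kbilinear_compose[OF bT klinear_id(2) klinear_id(2) kbilinear_left[OF bT ab']])
    show "kbilinear (tensor T B) (tensor A B) (tensor T B) (\<lambda>X Y. tact T B act X (tact A B (mmul A) Y (tpure A B a b)))"
      by (rule kbilinear_compose[OF bT klinear_id(2) kbilinear_left[OF bA ab'] klinear_id(2)])
  qed (use ab A B in \<open>simp add: pT pA rmodule_closed[OF T] rmodule_act_mul[OF T] kalgebra_assoc\<close>)
  show ?thesis
    by (rule tensor_ext[OF kmodule_tensor kbilinear_right[OF bT cT[OF X Y]]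
          klinear_compose[OF kbilinear_right[OF bA Y] kbilinear_right[OF bT X]] pure Z])
qed

lemma kalgebra_tensor_alg [simp]:
  assumes A: "kalgebra A" and B: "kalgebra B"
  shows "kalgebra (tensor_alg A B)"
proof -
  note AA = rmodule_mmul[OF A]
  note b = kbilinear_tact[OF A B AA]
  note r = klinear_smul[OF kbilinear_right[OF b]] klinear_add[OF kbilinear_right[OF b]]
    klinear_smul[OF kbilinear_left[OF b]] klinear_add[OF kbilinear_left[OF b]]
  have one: "tpure A B (mone A) (mone B) \<in> mcar (tensor A B)" using A B by simp
  \<comment> \<open>\<open>tact_one\<close> supplies the right unit law; a module action has no left
    counterpart, so this side is proved for the algebra itself.\<close>
  have "tact A B (mmul A) (tpure A B (mone A) (mone B)) X = X" if X: "X \<in> mcar (tensor A B)" for X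
    by (rule tensor_ext[OF kmodule_tensor kbilinear_right[OF b one] klinear_id(2) _ X])
      (simp add: A B tact_tpure[OF A B AA])
  then show ?thesis
    unfolding kalgebra_def
    by (simp add: tact_closed[OF A B AA] tact_assoc[OF A B AA] tact_one[OF A B AA] r one)
qed

text \<open>Taking \<open>T = A\<close> and \<open>\<phi> = f\<close> gives multiplicativity of
  \<open>f \<otimes> g\<close>, used for the coface maps and the counit. The module case with
  \<open>f = id\<close> gives \<open>E \<otimes> H\<close>-linearity of the transport map of a
  torsor.\<close>

lemma tmap_tact:
  assumes A: "kalgebra A" and B: "kalgebra B" and T: "rmodule A T act"
    and A': "kalgebra A'" and B': "kalgebra B'" and T': "rmodule A' T' act'"
    and \<phi>: "klinear T T' \<phi>" and f: "klinear A A' f" and g: "klinear B B' g"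
    and act: "\<And>t a. t \<in> mcar T \<Longrightarrow> a \<in> mcar A \<Longrightarrow> \<phi> (act t a) = act' (\<phi> t) (f a)"
    and mul: "\<And>b c. b \<in> mcar B \<Longrightarrow> c \<in> mcar B \<Longrightarrow> g (mmul B b c) = mmul B' (g b) (g c)"
    and X: "X \<in> mcar (tensor T B)" and Y: "Y \<in> mcar (tensor A B)"
  shows "tmap T' B' \<phi> g (tact T B act X Y) = tact T' B' act' (tmap T' B' \<phi> g X) (tmap A' B' f g Y)"
proof (rule tensor_ext_kbilinear[OF kmodule_tensor _ _ _ X Y])
  note m = kalgebra_kmodule[OF A] kalgebra_kmodule[OF B] rmodule_kmodule[OF T]
    kalgebra_kmodule[OF A'] kalgebra_kmodule[OF B'] rmodule_kmodule[OF T']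
  note l\<phi> = klinear_tmap[OF m(3,2,6,5) \<phi> g] and lf = klinear_tmap[OF m(1,2,4,5) f g]
  show "kbilinear (tensor T B) (tensor A B) (tensor T' B') (\<lambda>X Y. tmap T' B' \<phi> g (tact T B act X Y))"
    by (rule kbilinear_compose[OF kbilinear_tact[OF A B T] klinear_id(2) klinear_id(2) l\<phi>])
  show "kbilinear (tensor T B) (tensor A B) (tensor T' B')
      (\<lambda>X Y. tact T' B' act' (tmap T' B' \<phi> g X) (tmap A' B' f g Y))"
    by (rule kbilinear_compose[OF kbilinear_tact[OF A' B' T'] l\<phi> lf klinear_id(2)])
  fix t b a c assume "t \<in> mcar T" "b \<in> mcar B" "a \<in> mcar A" "c \<in> mcar B"
  then show "tmap T' B' \<phi> g (tact T B act (tpure T B t b) (tpure A B a c)) =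
      tact T' B' act' (tmap T' B' \<phi> g (tpure T B t b)) (tmap A' B' f g (tpure A B a c))"
    by (simp add: tact_tpure[OF A B T] tact_tpure[OF A' B' T'] tmap_tpure[OF m(3,2,6,5) \<phi> g]
        tmap_tpure[OF m(1,2,4,5) f g] rmodule_closed[OF T] B act mul
        klinear_closed[OF \<phi>] klinear_closed[OF f] klinear_closed[OF g])
qed

lemma assoc_inv_mul:
  assumes A: "kalgebra A" and B: "kalgebra B" and C: "kalgebra C"
    and X: "X \<in> mcar (tensor A (tensor B C))" and Y: "Y \<in> mcar (tensor A (tensor B C))"
  shows "assoc_inv A B C (mmul (tensor_alg A (tensor_alg B C)) X Y)
    = mmul (tensor_alg (tensor_alg A B) C) (assoc_inv A B C X) (assoc_inv A B C Y)"
proof -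
  let ?L = "mmul (tensor_alg A (tensor_alg B C))" and ?R = "mmul (tensor_alg (tensor_alg A B) C)"
  let ?a = "assoc_inv A B C"
  let ?t = "\<lambda>a b c. tpure A (tensor B C) a (tpure B C b c)"
  note m = kalgebra_kmodule[OF A] kalgebra_kmodule[OF B] kalgebra_kmodule[OF C]
  note la = klinear_assoc_inv[OF m]
  note BC = kalgebra_tensor_alg[OF B C] and AB = kalgebra_tensor_alg[OF A B]
  note bL = kbilinear_tact[OF A BC rmodule_mmul[OF A], simplified]
  note bR = kbilinear_tact[OF AB C rmodule_mmul[OF AB], simplified]
  note pL = tact_tpure[OF A BC rmodule_mmul[OF A], simplified]
  note pR = tact_tpure[OF AB C rmodule_mmul[OF AB], simplified]
  note pBC = tact_tpure[OF B C rmodule_mmul[OF B]] and pAB = tact_tpure[OF A B rmodule_mmul[OF A]]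
  have pure: "?a (?L (?t a b c) (?t a' b' c')) = ?R (?a (?t a b c)) (?a (?t a' b' c'))"
    if "a \<in> mcar A" "b \<in> mcar B" "c \<in> mcar C" "a' \<in> mcar A" "b' \<in> mcar B" "c' \<in> mcar C" for a b c a' b' c'
    using that A B C by (simp add: pL pR pAB pBC assoc_inv_tpure[OF m])
  \<comment> \<open>Extension one argument at a time: first \<open>Y\<close> with \<open>X\<close>
    pure, then \<open>X\<close>.\<close>
  have half: "?a (?L (?t a b c) Y) = ?R (?a (?t a b c)) (?a Y)"
    if abc: "a \<in> mcar A" "b \<in> mcar B" "c \<in> mcar C" for a b c
  proof (rule tensor_ext_right[OF m(1) kmodule_tensor _ _ _ Y])
    have t: "?t a b c \<in> mcar (tensor A (tensor B C))" using abc by simp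
    show "klinear (tensor A (tensor B C)) (tensor (tensor A B) C) (\<lambda>Y. ?a (?L (?t a b c) Y))"
      using klinear_compose[OF kbilinear_right[OF bL t] la] by simp
    show "klinear (tensor A (tensor B C)) (tensor (tensor A B) C) (\<lambda>Y. ?R (?a (?t a b c)) (?a Y))"
      using klinear_compose[OF la kbilinear_right[OF bR klinear_closed[OF la t]]] by simp
  qed (rule pure[OF abc])
  show ?thesis
  proof (rule tensor_ext_right[OF m(1) kmodule_tensor _ _ _ X])
    show "klinear (tensor A (tensor B C)) (tensor (tensor A B) C) (\<lambda>X. ?a (?L X Y))"
      using klinear_compose[OF kbilinear_left[OF bL Y] la] by simp
    show "klinear (tensor A (tensor B C)) (tensor (tensor A B) C) (\<lambda>X. ?R (?a X) (?a Y))"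
      using klinear_compose[OF la kbilinear_left[OF bR klinear_closed[OF la Y]]] by simp
  qed (rule half)
qed

section \<open>Functoriality, naturality, and units of algebras\<close>

lemma tmap_id:
  assumes M: "kmodule M" and N: "kmodule N" and X: "X \<in> mcar (tensor M N)"
  shows "tmap M N id id X = X"
  by (rule tensor_ext[OF kmodule_tensor klinear_tmap[OF M N M N klinear_id(1) klinear_id(1)] klinear_id(2) _ X])
    (simp add: tmap_tpure[OF M N M N klinear_id(1) klinear_id(1)])

lemma tmap_tmap:
  assumes M: "kmodule M" and N: "kmodule N" and M': "kmodule M'" and N': "kmodule N'"
    and M'': "kmodule M''" and N'': "kmodule N''"
    and f: "klinear M M' f" and g: "klinear N N' g"
    and f': "klinear M' M'' f'" and g': "klinear N' N'' g'" and X: "X \<in> mcar (tensor M N)"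
  shows "tmap M'' N'' f' g' (tmap M' N' f g X) = tmap M'' N'' (\<lambda>x. f' (f x)) (\<lambda>x. g' (g x)) X"
  by (rule tensor_ext[OF kmodule_tensor
        klinear_compose[OF klinear_tmap[OF M N M' N' f g] klinear_tmap[OF M' N' M'' N'' f' g']]
        klinear_tmap[OF M N M'' N'' klinear_compose[OF f f'] klinear_compose[OF g g']] _ X])
    (simp add: tmap_tpure[OF M N M' N' f g] tmap_tpure[OF M' N' M'' N'' f' g']
      tmap_tpure[OF M N M'' N'' klinear_compose[OF f f'] klinear_compose[OF g g']]
      klinear_closed[OF f] klinear_closed[OF g])

lemma tmap_inverse:
  assumes M: "kmodule M" and N: "kmodule N" and M': "kmodule M'"
    and f: "klinear M M' f" and f': "klinear M' M f'"
    and inv: "\<And>x. x \<in> mcar M \<Longrightarrow> f' (f x) = x" and X: "X \<in> mcar (tensor M N)"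
  shows "tmap M N f' id (tmap M' N f id X) = X"
  using tmap_tmap[OF M N M' N M N f klinear_id(1) f' klinear_id(1) X]
    tmap_cong[OF M N M N klinear_compose[OF f f'] klinear_id(1) klinear_id(1) _ X] inv
    tmap_id[OF M N X] by (simp add: id_def)

text \<open>Allows coassociativity of a torsor \<open>T\<close> to be carried to \<open>E\<close>
  along a linear map \<open>T \<rightarrow> E\<close>.\<close>

lemma assoc_inv_natural:
  assumes M: "kmodule M" and N: "kmodule N" and Q: "kmodule Q" and M': "kmodule M'"
    and f: "klinear M M' f" and X: "X \<in> mcar (tensor M (tensor N Q))"
  shows "tmap (tensor M' N) Q (tmap M' N f id) id (assoc_inv M N Q X)
    = assoc_inv M' N Q (tmap M' (tensor N Q) f id X)"
proof -
  note i = klinear_id(1)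
  note fN = klinear_tmap[OF M N M' N f i]
  note tN = tmap_tpure[OF M N M' N f i]
  note tQ = tmap_tpure[OF kmodule_tensor Q kmodule_tensor Q fN i]
  note tNQ = tmap_tpure[OF M kmodule_tensor M' kmodule_tensor f i]
  show ?thesis
    by (rule tensor_ext_right[OF M kmodule_tensor
          klinear_compose[OF klinear_assoc_inv[OF M N Q] klinear_tmap[OF kmodule_tensor Q kmodule_tensor Q fN i]]
          klinear_compose[OF klinear_tmap[OF M kmodule_tensor M' kmodule_tensor f i] klinear_assoc_inv[OF M' N Q]]
          _ X])
      (simp add: assoc_inv_tpure[OF M N Q] assoc_inv_tpure[OF M' N Q] tN tQ tNQ klinear_closed[OF f])
qed

lemma klinear_inv_into:
  assumes M: "kmodule M" and f: "klinear M N f" and bij: "bij_betw f (mcar M) (mcar N)"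
  shows "klinear N M (inv_into (mcar M) f)"
proof -
  let ?g = "inv_into (mcar M) f"
  have g: "?g y \<in> mcar M" "f (?g y) = y" if "y \<in> mcar N" for y
    using bij that by (auto simp: bij_betw_def inv_into_into f_inv_into_f)
  have gf: "?g (f x) = x" if "x \<in> mcar M" for x
    using bij that by (simp add: bij_betw_inv_into_left)
  have "?g (madd N x y) = madd M (?g x) (?g y)" if "x \<in> mcar N" "y \<in> mcar N" for x y
    using gf[of "madd M (?g x) (?g y)"] klinear_add[OF f g(1) g(1)] g(2) M g(1) that by simp
  moreover have "?g (msmul N c x) = msmul M c (?g x)" if "x \<in> mcar N" for c x
    using gf[of "msmul M c (?g x)"] klinear_smul[OF f g(1)] g(2) M g(1) that by simp
  ultimately show ?thesis using g(1) by (simp add: klinear_def)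
qed

text \<open>Links invertible cocycles with torsor points. Surjectivity yields a right inverse
  \<open>v\<close> of \<open>u\<close>, and injectivity applied to \<open>u (v u) = u 1\<close>
  makes it two-sided.\<close>

lemma mod_units_mmul:
  assumes A: "kalgebra A" shows "mod_units A A (mmul A) = alg_units A"
proof (intro set_eqI iffI)
  fix u assume "u \<in> mod_units A A (mmul A)"
  then have u: "u \<in> mcar A" and bij: "bij_betw (\<lambda>x. mmul A u x) (mcar A) (mcar A)"
    by (auto simp: mod_units_def)
  from bij obtain v where v: "v \<in> mcar A" "mmul A u v = mone A"
    using kalgebra_one[OF A] unfolding bij_betw_def by force
  have "mmul A u (mmul A v u) = mmul A u (mone A)"
    using A u v kalgebra_assoc[OF A u v(1) u] by simp
  then have "mmul A v u = mone A"
    by (rule inj_onD[OF bij_betw_imp_inj_on[OF bij]]) (use A u v in simp_all)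
  with u v show "u \<in> alg_units A" by (auto simp: alg_units_def)
next
  fix u assume "u \<in> alg_units A"
  then obtain v where u: "u \<in> mcar A" and v: "v \<in> mcar A" "mmul A u v = mone A" "mmul A v u = mone A"
    by (auto simp: alg_units_def)
  have "bij_betw (\<lambda>x. mmul A u x) (mcar A) (mcar A)"
    by (rule bij_betw_byWitness[where f' = "mmul A v"])
      (use A u v in \<open>auto simp: kalgebra_assoc[symmetric]\<close>)
  with u show "u \<in> mod_units A A (mmul A)" by (simp add: mod_units_def)
qed

section \<open>Hopf torsors and cocycles\<close>

locale hopf_comodule_algebra =
  fixes H :: "('k::field, 'h) kalg" and \<Delta> :: "'h \<Rightarrow> ('h \<times> 'h \<Rightarrow> 'k) set"
    and \<epsilon> :: "'h \<Rightarrow> 'k" and S :: "'h \<Rightarrow> 'h"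
    and E :: "('k, 'e) kalg" and \<Delta>E :: "'e \<Rightarrow> ('e \<times> 'h \<Rightarrow> 'k) set"
  assumes hopf: "hopf_algebra H \<Delta> \<epsilon> S"
    and comod: "comodule_algebra H \<Delta> \<epsilon> E \<Delta>E"
begin

lemma H [simp]: "kalgebra H" and E [simp]: "kalgebra E"
  using hopf comod by (simp_all add: hopf_algebra_def comodule_algebra_def)

lemma Hm [simp]: "kmodule H" and Em [simp]: "kmodule E"
  by simp_all

lemma EH: "kalgebra (tensor_alg E H)" and HH: "kalgebra (tensor_alg H H)"
  by simp_all

lemma \<Delta>_linear: "klinear H (tensor H H) \<Delta>"
  and \<Delta>_mul: "x \<in> mcar H \<Longrightarrow> y \<in> mcar H \<Longrightarrow> \<Delta> (mmul H x y) = tact H H (mmul H) (\<Delta> x) (\<Delta> y)"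
  and \<Delta>_one: "\<Delta> (mone H) = tpure H H (mone H) (mone H)"
  using hopf by (simp_all add: hopf_algebra_def alg_hom_def)

lemma \<epsilon>_add: "x \<in> mcar H \<Longrightarrow> y \<in> mcar H \<Longrightarrow> \<epsilon> (madd H x y) = \<epsilon> x + \<epsilon> y"
  and \<epsilon>_smul: "x \<in> mcar H \<Longrightarrow> \<epsilon> (msmul H c x) = c * \<epsilon> x"
  and \<epsilon>_mul: "x \<in> mcar H \<Longrightarrow> y \<in> mcar H \<Longrightarrow> \<epsilon> (mmul H x y) = \<epsilon> x * \<epsilon> y"
  and \<epsilon>_one: "\<epsilon> (mone H) = 1"
  and counit_left: "x \<in> mcar H \<Longrightarrow> tlift H (\<lambda>a b. msmul H (\<epsilon> a) b) (\<Delta> x) = x"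
  using hopf by (simp_all add: hopf_algebra_def)

lemma \<Delta>E_linear: "klinear E (tensor E H) \<Delta>E"
  and \<Delta>E_mul: "x \<in> mcar E \<Longrightarrow> y \<in> mcar E \<Longrightarrow> \<Delta>E (mmul E x y) = tact E H (mmul E) (\<Delta>E x) (\<Delta>E y)"
  and \<Delta>E_one: "\<Delta>E (mone E) = tpure E H (mone E) (mone H)"
  and \<Delta>E_coassoc: "x \<in> mcar E \<Longrightarrow> cd0 E H \<Delta>E (\<Delta>E x) = cd1 E H \<Delta> (\<Delta>E x)"
  and \<Delta>E_counit: "x \<in> mcar E \<Longrightarrow> tlift E (\<lambda>y h. msmul E (\<epsilon> h) y) (\<Delta>E x) = x"
  using comod by (simp_all add: comodule_algebra_def alg_hom_def cd0_def cd1_def)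

lemma \<Delta>E_closed [simp]: "x \<in> mcar E \<Longrightarrow> \<Delta>E x \<in> mcar (tensor E H)"
  by (rule klinear_closed[OF \<Delta>E_linear])

abbreviation mul2 (infixl "\<cdot>" 70) where "X \<cdot> Y \<equiv> tact E H (mmul E) X Y"
abbreviation mul3 (infixl "\<odot>" 70) where "X \<odot> Y \<equiv> tact (tensor_alg E H) H (tact E H (mmul E)) X Y"
abbreviation "one2 \<equiv> tpure E H (mone E) (mone H)"

lemmas bilinear2 = kbilinear_tact[OF E H rmodule_mmul[OF E]]
lemmas pure2 = tact_tpure[OF E H rmodule_mmul[OF E]]
lemmas bilinear3 = kbilinear_tact[OF EH H rmodule_mmul[OF EH], simplified]
lemmas pure3 = tact_tpure[OF EH H rmodule_mmul[OF EH], simplified]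

lemma mul2_closed [simp]: "X \<in> mcar (tensor E H) \<Longrightarrow> Y \<in> mcar (tensor E H) \<Longrightarrow> X \<cdot> Y \<in> mcar (tensor E H)"
  by (rule kbilinear_closed[OF bilinear2])

lemma mul2_assoc: "X \<in> mcar (tensor E H) \<Longrightarrow> Y \<in> mcar (tensor E H) \<Longrightarrow> Z \<in> mcar (tensor E H)
    \<Longrightarrow> (X \<cdot> Y) \<cdot> Z = X \<cdot> (Y \<cdot> Z)"
  by (rule tact_assoc[OF E H rmodule_mmul[OF E]])

lemma mul2_one [simp]: "X \<in> mcar (tensor E H) \<Longrightarrow> X \<cdot> one2 = X" "X \<in> mcar (tensor E H) \<Longrightarrow> one2 \<cdot> X = X"
  using kalgebra_one_right[OF EH] kalgebra_one_left[OF EH] by simp_all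

lemma mul3_assoc:
  assumes "X \<in> mcar (tensor (tensor E H) H)" "Y \<in> mcar (tensor (tensor E H) H)" "Z \<in> mcar (tensor (tensor E H) H)"
  shows "(X \<odot> Y) \<odot> Z = X \<odot> (Y \<odot> Z)"
  using tact_assoc[OF EH H rmodule_mmul[OF EH], of X Y Z] assms by simp

section \<open>Coface maps\<close>

lemma klinear_cd0: "klinear (tensor E H) (tensor (tensor E H) H) (cd0 E H \<Delta>E)"
  and cd0_tpure: "x \<in> mcar E \<Longrightarrow> h \<in> mcar H \<Longrightarrow> cd0 E H \<Delta>E (tpure E H x h) = tpure (tensor E H) H (\<Delta>E x) h"
  using klinear_tmap[OF Em Hm kmodule_tensor Hm \<Delta>E_linear klinear_id(1)]
    tmap_tpure[OF Em Hm kmodule_tensor Hm \<Delta>E_linear klinear_id(1)]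
  by (simp_all add: cd0_def[abs_def])

lemma klinear_tmap_\<Delta>: "klinear (tensor E H) (tensor E (tensor H H)) (tmap E (tensor H H) id \<Delta>)"
  by (rule klinear_tmap[OF Em Hm Em kmodule_tensor klinear_id(1) \<Delta>_linear])

lemma klinear_cd1: "klinear (tensor E H) (tensor (tensor E H) H) (cd1 E H \<Delta>)"
  and cd1_tpure: "x \<in> mcar E \<Longrightarrow> h \<in> mcar H
    \<Longrightarrow> cd1 E H \<Delta> (tpure E H x h) = assoc_inv E H H (tpure E (tensor H H) x (\<Delta> h))"
  using klinear_compose[OF klinear_tmap_\<Delta> klinear_assoc_inv[OF Em Hm Hm]]
    tmap_tpure[OF Em Hm Em kmodule_tensor klinear_id(1) \<Delta>_linear]
  by (simp_all add: cd1_def[abs_def])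

lemma cd0_mul:
  assumes "X \<in> mcar (tensor E H)" "Y \<in> mcar (tensor E H)"
  shows "cd0 E H \<Delta>E (X \<cdot> Y) = cd0 E H \<Delta>E X \<odot> cd0 E H \<Delta>E Y"
  using tmap_tact[OF E H rmodule_mmul[OF E] EH H rmodule_mmul[OF EH], of \<Delta>E \<Delta>E id X Y] assms
  by (simp add: cd0_def \<Delta>E_linear \<Delta>E_mul)

text \<open>\<open>cd1\<close> is \<open>id \<otimes> \<Delta>\<close> followed by reassociation.
  Multiplicativity of \<open>\<Delta>\<close> settles the first map and \<open>assoc_inv_mul\<close>
  the second.\<close>

lemma cd1_mul:
  assumes X: "X \<in> mcar (tensor E H)" and Y: "Y \<in> mcar (tensor E H)"
  shows "cd1 E H \<Delta> (X \<cdot> Y) = cd1 E H \<Delta> X \<odot> cd1 E H \<Delta> Y"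
  using tmap_tact[OF E H rmodule_mmul[OF E] E HH rmodule_mmul[OF E], of id id \<Delta> X Y]
    assoc_inv_mul[OF E H H klinear_closed[OF klinear_tmap_\<Delta> X] klinear_closed[OF klinear_tmap_\<Delta> Y]] assms
  by (simp add: cd1_def \<Delta>_linear \<Delta>_mul)

lemma Z1_iff:
  "X \<in> Z1 H \<Delta> E \<Delta>E \<longleftrightarrow> X \<in> alg_units (tensor_alg E H) \<and>
     tpure (tensor E H) H X (mone H) \<odot> cd0 E H \<Delta>E X = cd1 E H \<Delta> X"
  by (simp add: Z1_def cd2_def)

lemma Z1_closed: "X \<in> Z1 H \<Delta> E \<Delta>E \<Longrightarrow> X \<in> mcar (tensor E H)"
  by (simp add: Z1_def alg_units_def)

section \<open>Twisted coactions\<close>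

lemma twist_eq: "twist E H \<Delta>E X x = X \<cdot> \<Delta>E x"
  by (simp add: twist_def)

lemma klinear_twist:
  assumes "X \<in> mcar (tensor E H)" shows "klinear E (tensor E H) (twist E H \<Delta>E X)"
  using klinear_compose[OF \<Delta>E_linear kbilinear_right[OF bilinear2 assms]]
  by (simp add: twist_eq[abs_def])

text \<open>The coaction of the twisted module is expressed through the coface maps, so that
  coassociativity becomes the cocycle identity.\<close>

lemma tmap_twist:
  assumes X: "X \<in> mcar (tensor E H)" and Y: "Y \<in> mcar (tensor E H)"
  shows "tmap (tensor E H) H (twist E H \<Delta>E X) id Y = tpure (tensor E H) H X (mone H) \<odot> cd0 E H \<Delta>E Y"
proof -
  have X1: "tpure (tensor E H) H X (mone H) \<in> mcar (tensor (tensor E H) H)"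
    using X by simp
  show ?thesis
    \<comment> \<open>On \<open>y \<otimes> h\<close> both sides are
      \<open>(X \<cdot> \<Delta>E y) \<otimes> h\<close>.\<close>
    by (rule tensor_ext[OF kmodule_tensor
          klinear_tmap[OF Em Hm kmodule_tensor Hm klinear_twist[OF X] klinear_id(1)]
          klinear_compose[OF klinear_cd0 kbilinear_right[OF bilinear3 X1]] _ Y])
      (simp add: tmap_tpure[OF Em Hm kmodule_tensor Hm klinear_twist[OF X] klinear_id(1)]
        cd0_tpure pure3 X twist_eq)
qed

lemma twist_coassoc:
  assumes X: "X \<in> Z1 H \<Delta> E \<Delta>E" and x: "x \<in> mcar E"
  shows "tmap (tensor E H) H (twist E H \<Delta>E X) id (twist E H \<Delta>E X x) = cd1 E H \<Delta> (twist E H \<Delta>E X x)"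
proof -
  let ?X1 = "tpure (tensor E H) H X (mone H)"
  note Xc = Z1_closed[OF X]
  have "tmap (tensor E H) H (twist E H \<Delta>E X) id (X \<cdot> \<Delta>E x) = ?X1 \<odot> (cd0 E H \<Delta>E X \<odot> cd0 E H \<Delta>E (\<Delta>E x))"
    using Xc x by (simp add: tmap_twist cd0_mul)
  also have "\<dots> = (?X1 \<odot> cd0 E H \<Delta>E X) \<odot> cd0 E H \<Delta>E (\<Delta>E x)"
    using Xc x by (simp add: mul3_assoc klinear_closed[OF klinear_cd0])
  \<comment> \<open>The cocycle identity turns the bracket into \<open>cd1\<close> of
    \<open>X\<close>, coassociativity of \<open>E\<close> turns the last factor into
    \<open>cd1\<close> of \<open>\<Delta>E x\<close>, and \<open>cd1\<close> is
    multiplicative.\<close>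
  also have "\<dots> = cd1 E H \<Delta> (X \<cdot> \<Delta>E x)"
    using X Xc x by (simp add: Z1_iff \<Delta>E_coassoc cd1_mul)
  finally show ?thesis by (simp add: twist_eq)
qed

section \<open>The counit of a cocycle\<close>

text \<open>This is \<open>id \<otimes> \<epsilon>\<close> followed by the identification of
  \<open>E \<otimes> k\<close> with \<open>E\<close>.\<close>

definition counitE :: "('e \<times> 'h \<Rightarrow> 'k) set \<Rightarrow> 'e" where
  "counitE = tlift E (\<lambda>y h. msmul E (\<epsilon> h) y)"

lemma kbilinear_counitE: "kbilinear E H E (\<lambda>y h. msmul E (\<epsilon> h) y)"
proof (rule kbilinearI)
  show "klinear H E (\<lambda>h. msmul E (\<epsilon> h) y)" if "y \<in> mcar E" for y
    using that by (simp add: klinear_def \<epsilon>_add \<epsilon>_smul kmodule_smul_distrib kmodule_smul_smul)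
  show "klinear E E (\<lambda>y. msmul E (\<epsilon> h) y)" for h
    by (rule klinear_pointwise_smul) simp_all
qed

lemma klinear_counitE: "klinear (tensor E H) E counitE"
  and counitE_tpure: "x \<in> mcar E \<Longrightarrow> h \<in> mcar H \<Longrightarrow> counitE (tpure E H x h) = msmul E (\<epsilon> h) x"
  using klinear_tlift[OF Em Hm Em kbilinear_counitE] tlift_tpure[OF Em Hm Em kbilinear_counitE]
  by (simp_all add: counitE_def)

text \<open>Rests on multiplicativity of \<open>\<epsilon>\<close>. It splits the counit of
  \<open>X \<cdot> \<Delta>E x\<close> into one factor for \<open>X\<close> and one for
  \<open>x\<close>.\<close>

lemma counitE_mul:
  assumes X: "X \<in> mcar (tensor E H)" and Y: "Y \<in> mcar (tensor E H)"
  shows "counitE (X \<cdot> Y) = mmul E (counitE X) (counitE Y)"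
proof (rule tensor_ext_kbilinear[OF Em _ _ _ X Y])
  show "kbilinear (tensor E H) (tensor E H) E (\<lambda>X Y. counitE (X \<cdot> Y))"
    by (rule kbilinear_compose[OF bilinear2 klinear_id(2) klinear_id(2) klinear_counitE])
  show "kbilinear (tensor E H) (tensor E H) E (\<lambda>X Y. mmul E (counitE X) (counitE Y))"
    by (rule kbilinear_compose[OF kbilinear_mmul[OF E] klinear_counitE klinear_counitE klinear_id(2)])
qed (simp add: pure2 counitE_tpure \<epsilon>_mul kalgebra_mul_smul kalgebra_smul_mul
      mult.commute flip: kmodule_smul_smul)

lemma counitE_\<Delta>E: "x \<in> mcar E \<Longrightarrow> counitE (\<Delta>E x) = x"
  by (simp add: counitE_def \<Delta>E_counit)

lemmas klinear_tmap_counitE = klinear_tmap[OF kmodule_tensor Hm Em Hm klinear_counitE klinear_id(1)]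
lemmas tmap_counitE_tpure = tmap_tpure[OF kmodule_tensor Hm Em Hm klinear_counitE klinear_id(1)]

lemma tmap_counitE_mul:
  assumes "X \<in> mcar (tensor (tensor E H) H)" "Y \<in> mcar (tensor (tensor E H) H)"
  shows "tmap E H counitE id (X \<odot> Y) = tmap E H counitE id X \<cdot> tmap E H counitE id Y"
  using tmap_tact[OF EH H rmodule_mmul[OF EH] E H rmodule_mmul[OF E], of counitE counitE id X Y] assms
  by (simp add: klinear_counitE counitE_mul)

text \<open>The counit axiom of \<open>E\<close>, applied in the first factor.\<close>

lemma tmap_counitE_cd0:
  assumes X: "X \<in> mcar (tensor E H)" shows "tmap E H counitE id (cd0 E H \<Delta>E X) = X"
  by (rule tensor_ext[OF kmodule_tensor klinear_compose[OF klinear_cd0 klinear_tmap_counitE] klinear_id(2) _ X])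
    (simp add: cd0_tpure tmap_counitE_tpure counitE_\<Delta>E)

text \<open>The left counit axiom of \<open>H\<close>: after reassociation,
  \<open>\<epsilon>\<close> hits the first leg of \<open>\<Delta> h\<close>.\<close>

lemma tmap_counitE_cd1:
  assumes X: "X \<in> mcar (tensor E H)" shows "tmap E H counitE id (cd1 E H \<Delta> X) = X"
proof (rule tensor_ext[OF kmodule_tensor klinear_compose[OF klinear_cd1 klinear_tmap_counitE] klinear_id(2) _ X])
  fix x h assume x: "x \<in> mcar E" and h: "h \<in> mcar H"
  let ?l = "tlift H (\<lambda>a b. msmul H (\<epsilon> a) b)"
  have b: "kbilinear H H H (\<lambda>a b. msmul H (\<epsilon> a) b)"
  proof (rule kbilinearI)
    show "klinear H H (\<lambda>h. msmul H (\<epsilon> h) y)" if "y \<in> mcar H" for y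
      using that by (simp add: klinear_def \<epsilon>_add \<epsilon>_smul kmodule_smul_distrib kmodule_smul_smul)
    show "klinear H H (\<lambda>y. msmul H (\<epsilon> h) y)" for h
      by (rule klinear_pointwise_smul) simp_all
  qed
  note t = kbilinear_right[OF kbilinear_tpure[OF Em kmodule_tensor] x]
  note tH = kbilinear_right[OF kbilinear_tpure[OF Em Hm] x]
  \<comment> \<open>\<open>\<Delta> h\<close> need not be pure, so it is replaced by an arbitrary
    \<open>Y\<close> to which extension from pure tensors applies.\<close>
  have "tmap E H counitE id (assoc_inv E H H (tpure E (tensor H H) x Y)) = tpure E H x (?l Y)"
    if Y: "Y \<in> mcar (tensor H H)" for Y
  proof (rule tensor_ext[OF kmodule_tensor
        klinear_compose[OF klinear_compose[OF t klinear_assoc_inv[OF Em Hm Hm]] klinear_tmap_counitE]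
        klinear_compose[OF klinear_tlift[OF Hm Hm Hm b] tH] _ Y])
    fix a c assume ac: "a \<in> mcar H" "c \<in> mcar H"
    have "tpure E H (msmul E (\<epsilon> a) x) c = tpure E H x (msmul H (\<epsilon> a) c)"
      using klinear_smul[OF kbilinear_left[OF kbilinear_tpure[OF Em Hm] ac(2)] x]
        klinear_smul[OF tH ac(2)] by simp
    then show "tmap E H counitE id (assoc_inv E H H (tpure E (tensor H H) x (tpure H H a c)))
        = tpure E H x (?l (tpure H H a c))"
      using x ac by (simp add: assoc_inv_tpure[OF Em Hm Hm] tmap_counitE_tpure counitE_tpure tlift_tpure[OF Hm Hm Hm b])
  qed
  then show "tmap E H counitE id (cd1 E H \<Delta> (tpure E H x h)) = tpure E H x h"
    using x h by (simp add: cd1_tpure klinear_closed[OF \<Delta>_linear] counit_left)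
qed

text \<open>Applying the counit to the middle tensor factor of the cocycle identity gives
  \<open>(counitE X \<otimes> 1) X = X\<close>, and \<open>X\<close> can be cancelled.\<close>

lemma counitE_cocycle:
  assumes X: "X \<in> Z1 H \<Delta> E \<Delta>E" shows "counitE X = mone E"
proof -
  note Xc = Z1_closed[OF X]
  have e: "counitE X \<in> mcar E" using klinear_closed[OF klinear_counitE Xc] .
  obtain Y where Y: "Y \<in> mcar (tensor E H)" "X \<cdot> Y = one2"
    using X by (auto simp: Z1_iff alg_units_def)
  have "tmap E H counitE id (tpure (tensor E H) H X (mone H) \<odot> cd0 E H \<Delta>E X) = X"
    using X Xc tmap_counitE_cd1 by (simp add: Z1_iff)
  then have "tpure E H (counitE X) (mone H) \<cdot> X = X"
    using Xc by (simp add: tmap_counitE_mul tmap_counitE_cd0 tmap_counitE_tpure klinear_closed[OF klinear_cd0])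
  then have "tpure E H (counitE X) (mone H) \<cdot> one2 = one2"
    unfolding Y(2)[symmetric] using Xc Y(1) e by (simp flip: mul2_assoc)
  then have "tpure E H (counitE X) (mone H) = one2" using e by simp
  \<comment> \<open>A second application of \<open>counitE\<close> strips the factor in
    \<open>H\<close>, since \<open>\<epsilon>\<close> sends \<open>1\<close> to
    \<open>1\<close>.\<close>
  then have "counitE (tpure E H (counitE X) (mone H)) = counitE one2" by simp
  then show ?thesis using e by (simp add: counitE_tpure \<epsilon>_one)
qed

lemma torsor_twist:
  assumes X: "X \<in> Z1 H \<Delta> E \<Delta>E"
  shows "hopf_torsor H \<Delta> \<epsilon> E \<Delta>E E (mmul E) (twist E H \<Delta>E X)"
proof -
  note Xc = Z1_closed[OF X]
  \<comment> \<open>For the counit law, \<open>counitE\<close> sends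
    \<open>X \<cdot> \<Delta>E x\<close> to \<open>counitE X\<close> times \<open>x\<close>, and the
    first factor is \<open>1\<close>.\<close>
  have "rcomodule H \<Delta> \<epsilon> E (twist E H \<Delta>E X)"
    unfolding rcomodule_def counitE_def[symmetric]
    using klinear_twist[OF Xc] twist_coassoc[OF X] Xc
    by (simp add: cd1_def twist_eq counitE_mul counitE_cocycle[OF X] counitE_\<Delta>E)
  then have "hopf_module H \<Delta> \<epsilon> E \<Delta>E E (mmul E) (twist E H \<Delta>E X)"
    unfolding hopf_module_def
    using Xc by (simp add: rmodule_mmul twist_eq \<Delta>E_mul mul2_assoc)
  \<comment> \<open>\<open>\<Delta>E\<close> sends \<open>1\<close> to \<open>1 \<otimes> 1\<close>,
    so the twisted coaction sends \<open>1\<close> to \<open>X\<close>; the second torsor condition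
    is the invertibility of \<open>X\<close>.\<close>
  moreover have "mone E \<in> torsor_points H E E (mmul E) (twist E H \<Delta>E X)"
  proof -
    have "mone E \<in> mod_units E E (mmul E)"
      by (auto simp: mod_units_mmul alg_units_def)
    moreover have "X \<in> mod_units (tensor_alg E H) (tensor E H) (tact E H (mmul E))"
      using X mod_units_mmul[OF EH] by (simp add: Z1_iff mod_units_def)
    ultimately show ?thesis
      using Xc by (simp add: torsor_points_def twist_eq \<Delta>E_one)
  qed
  ultimately show ?thesis by (auto simp: hopf_torsor_def)
qed

section \<open>Cohomologous elements and isomorphic twists\<close>

text \<open>Stated for any \<open>\<phi>\<close> agreeing with left multiplication on the carrier,
  because an abstract isomorphism is known only there.\<close>

lemma tmap_mmul_left:
  assumes u: "u \<in> mcar E" and Y: "Y \<in> mcar (tensor E H)"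
    and \<phi>: "klinear E E \<phi>" and eq: "\<And>x. x \<in> mcar E \<Longrightarrow> \<phi> x = mmul E u x"
  shows "tmap E H \<phi> id Y = tpure E H u (mone H) \<cdot> Y"
proof -
  have u1: "tpure E H u (mone H) \<in> mcar (tensor E H)" using u by simp
  show ?thesis
    by (rule tensor_ext[OF kmodule_tensor klinear_tmap[OF Em Hm Em Hm \<phi> klinear_id(1)]
          kbilinear_right[OF bilinear2 u1] _ Y])
      (simp add: tmap_tpure[OF Em Hm Em Hm \<phi> klinear_id(1)] pure2 u eq)
qed

text \<open>The isomorphism is left multiplication by the inverse of the unit that moves
  \<open>X\<close> to \<open>Y\<close>. Conversely \<open>\<phi>\<close> applied to \<open>1\<close>
  is that inverse.\<close>

lemma cohomologous_iff_iso:
  assumes X: "X \<in> mcar (tensor E H)" and Y: "Y \<in> mcar (tensor E H)"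
  shows "cohomologous H E \<Delta>E X Y \<longleftrightarrow>
    hm_iso H E E (mmul E) (twist E H \<Delta>E X) E (mmul E) (twist E H \<Delta>E Y)"
proof
  assume "cohomologous H E \<Delta>E X Y"
  then obtain x v where x: "x \<in> mcar E" and v: "v \<in> mcar E"
    and xv: "mmul E x v = mone E" and vx: "mmul E v x = mone E"
    and Y_eq: "Y = (tpure E H v (mone H) \<cdot> X) \<cdot> \<Delta>E x"
    by (auto simp: cohomologous_def)
  have lin: "klinear E E (mmul E v)" by (rule kbilinear_right[OF kbilinear_mmul[OF E] v])
  have "v \<in> alg_units E" using x v xv vx by (auto simp: alg_units_def)
  then have "bij_betw (mmul E v) (mcar E) (mcar E)"
    by (simp add: mod_units_mmul[OF E, symmetric] mod_units_def)
  moreover have "twist E H \<Delta>E Y (mmul E v t) = tmap E H (mmul E v) id (twist E H \<Delta>E X t)"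
    if t: "t \<in> mcar E" for t
  proof -
    \<comment> \<open>This cancels the factor \<open>\<Delta>E x\<close> at the right end of
      \<open>Y\<close>.\<close>
    have "\<Delta>E x \<cdot> \<Delta>E (mmul E v t) = \<Delta>E t"
      using x v t xv kalgebra_assoc[OF E x v t] by (simp flip: \<Delta>E_mul)
    then show ?thesis
      using x v t X by (simp add: twist_eq Y_eq mul2_assoc tmap_mmul_left[OF v _ lin])
  qed
  ultimately show "hm_iso H E E (mmul E) (twist E H \<Delta>E X) E (mmul E) (twist E H \<Delta>E Y)"
    unfolding hm_iso_def using lin v by (intro exI[of _ "mmul E v"]) (simp add: kalgebra_assoc)
next
  assume "hm_iso H E E (mmul E) (twist E H \<Delta>E X) E (mmul E) (twist E H \<Delta>E Y)"
  then obtain \<phi> where bij: "bij_betw \<phi> (mcar E) (mcar E)" and lin: "klinear E E \<phi>"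
    and act: "\<And>t x. t \<in> mcar E \<Longrightarrow> x \<in> mcar E \<Longrightarrow> \<phi> (mmul E t x) = mmul E (\<phi> t) x"
    and col: "\<And>t. t \<in> mcar E \<Longrightarrow> twist E H \<Delta>E Y (\<phi> t) = tmap E H \<phi> id (twist E H \<Delta>E X t)"
    unfolding hm_iso_def by blast
  define u where "u = \<phi> (mone E)"
  have u: "u \<in> mcar E" using klinear_closed[OF lin] by (simp add: u_def)
  have \<phi>: "\<phi> x = mmul E u x" if "x \<in> mcar E" for x
    using act[of "mone E" x] that by (simp add: u_def)
  have "bij_betw (mmul E u) (mcar E) (mcar E)"
    using bij \<phi> by (simp cong: bij_betw_cong)
  then have "u \<in> alg_units E" using u by (simp add: mod_units_mmul[OF E, symmetric] mod_units_def)
  then obtain x where x: "x \<in> mcar E" "mmul E u x = mone E" "mmul E x u = mone E"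
    by (auto simp: alg_units_def)
  have "Y \<cdot> \<Delta>E u = tpure E H u (mone H) \<cdot> X"
    using col[of "mone E"] u X by (simp add: twist_eq \<phi> \<Delta>E_one tmap_mmul_left[OF u X lin \<phi>])
  \<comment> \<open>Since \<open>u x = 1\<close>, multiplying by \<open>\<Delta>E x\<close> removes
    \<open>\<Delta>E u\<close> and leaves \<open>Y\<close> in the required form.\<close>
  then have "(Y \<cdot> \<Delta>E u) \<cdot> \<Delta>E x = (tpure E H u (mone H) \<cdot> X) \<cdot> \<Delta>E x" by simp
  then have "Y = (tpure E H u (mone H) \<cdot> X) \<cdot> \<Delta>E x"
    using u x Y by (simp add: mul2_assoc \<Delta>E_one flip: \<Delta>E_mul)
  then show "cohomologous H E \<Delta>E X Y"
    unfolding cohomologous_def using u x by auto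
qed

text \<open>A torsor point \<open>u\<close> identifies \<open>T\<close> with \<open>E\<close>; the cocycle is the image of \<open>\<Delta>T u\<close>.\<close>

lemma torsor_iso_twist:
  fixes T :: "('k, 't) kmod"
  assumes torsor: "hopf_torsor H \<Delta> \<epsilon> E \<Delta>E T act \<Delta>T"
  shows "\<exists>X\<in>Z1 H \<Delta> E \<Delta>E. hm_iso H E T act \<Delta>T E (mmul E) (twist E H \<Delta>E X)"
proof -
  have T: "rmodule E T act" and \<Delta>T: "klinear T (tensor T H) \<Delta>T"
    and coassoc: "\<And>t. t \<in> mcar T \<Longrightarrow>
      tmap (tensor T H) H \<Delta>T id (\<Delta>T t) = assoc_inv T H H (tmap T (tensor H H) id \<Delta> (\<Delta>T t))"
    and \<Delta>T_act: "\<And>t x. t \<in> mcar T \<Longrightarrow> x \<in> mcar E \<Longrightarrow> \<Delta>T (act t x) = tact T H act (\<Delta>T t) (\<Delta>E x)"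
    using torsor by (simp_all add: hopf_torsor_def hopf_module_def rcomodule_def)
  note Tm = rmodule_kmodule[OF T]
  obtain u where u: "u \<in> mcar T" and bij_u: "bij_betw (act u) (mcar E) (mcar T)"
    and bij_\<Delta>u: "bij_betw (tact T H act (\<Delta>T u)) (mcar (tensor E H)) (mcar (tensor T H))"
    using torsor by (auto simp: hopf_torsor_def torsor_points_def mod_units_def)
  have \<theta>: "klinear E T (act u)" by (rule kbilinear_right[OF kbilinear_act[OF E T] u])
  define \<psi> where "\<psi> = inv_into (mcar E) (act u)"
  define \<Psi> where "\<Psi> = tmap E H \<psi> id"
  have \<psi>: "klinear T E \<psi>" unfolding \<psi>_def by (rule klinear_inv_into[OF Em \<theta> bij_u])
  have \<psi>\<theta>: "\<psi> (act u x) = x" if "x \<in> mcar E" for x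
    using that bij_u by (simp add: \<psi>_def bij_betw_inv_into_left)
  have \<theta>\<psi>: "act u (\<psi> t) = t" if "t \<in> mcar T" for t
    using that bij_u by (simp add: \<psi>_def bij_betw_inv_into_right)
  \<comment> \<open>Write \<open>t = u \<psi>(t)\<close>; then \<open>t x = u (\<psi>(t) x)\<close>,
    and \<open>\<psi>\<close> undoes the action on \<open>u\<close>.\<close>
  have \<psi>_act: "\<psi> (act t x) = mmul E (\<psi> t) x" if t: "t \<in> mcar T" and x: "x \<in> mcar E" for t x
    using \<psi>\<theta>[of "mmul E (\<psi> t) x"] rmodule_act_mul[OF T u _ x] \<theta>\<psi>[OF t] klinear_closed[OF \<psi> t] x by simp
  have \<Psi>: "klinear (tensor T H) (tensor E H) \<Psi>"
    unfolding \<Psi>_def by (rule klinear_tmap[OF Tm Hm Em Hm \<psi> klinear_id(1)])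
  have \<Psi>_act: "\<Psi> (tact T H act Z Y) = \<Psi> Z \<cdot> Y" if "Z \<in> mcar (tensor T H)" "Y \<in> mcar (tensor E H)" for Z Y
    using tmap_tact[OF E H T E H rmodule_mmul[OF E] \<psi> klinear_id(1) klinear_id(1) _ _ that] \<psi>_act
      tmap_id[OF Em Hm that(2)] by (simp add: \<Psi>_def)
  have bij_\<Psi>: "bij_betw \<Psi> (mcar (tensor T H)) (mcar (tensor E H))"
  proof (rule bij_betw_byWitness[where f' = "tmap T H (act u) id"])
    show "\<forall>Z\<in>mcar (tensor T H). tmap T H (act u) id (\<Psi> Z) = Z"
      unfolding \<Psi>_def using tmap_inverse[OF Tm Hm Em \<psi> \<theta> \<theta>\<psi>] by blast
    show "\<forall>Y\<in>mcar (tensor E H). \<Psi> (tmap T H (act u) id Y) = Y"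
      unfolding \<Psi>_def using tmap_inverse[OF Em Hm Tm \<theta> \<psi> \<psi>\<theta>] by blast
    show "\<Psi> ` mcar (tensor T H) \<subseteq> mcar (tensor E H)" using klinear_closed[OF \<Psi>] by blast
    show "tmap T H (act u) id ` mcar (tensor E H) \<subseteq> mcar (tensor T H)"
      using klinear_closed[OF klinear_tmap[OF Em Hm Tm Hm \<theta> klinear_id(1)]] by blast
  qed
  have \<Delta>Tu: "\<Delta>T u \<in> mcar (tensor T H)" by (rule klinear_closed[OF \<Delta>T u])
  define X where "X = \<Psi> (\<Delta>T u)"
  have X: "X \<in> mcar (tensor E H)" unfolding X_def by (rule klinear_closed[OF \<Psi> \<Delta>Tu])
  \<comment> \<open>By linearity of \<open>\<Psi>\<close> this composite of two bijections is left
    multiplication by \<open>X\<close>, so \<open>X\<close> is a unit.\<close>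
  have "bij_betw (\<lambda>Y. \<Psi> (tact T H act (\<Delta>T u) Y)) (mcar (tensor E H)) (mcar (tensor E H))"
    using bij_betw_trans[OF bij_\<Delta>u bij_\<Psi>] by (simp add: comp_def)
  then have "bij_betw (\<lambda>Y. X \<cdot> Y) (mcar (tensor E H)) (mcar (tensor E H))"
    using \<Psi>_act[OF \<Delta>Tu] by (simp add: X_def cong: bij_betw_cong)
  then have unit: "X \<in> alg_units (tensor_alg E H)"
    using mod_units_mmul[OF EH] X by (auto simp: mod_units_def)
  \<comment> \<open>Colinearity of \<open>\<psi>\<close>, again from \<open>t = u \<psi>(t)\<close>:
    \<open>\<Delta>T t\<close> is \<open>\<Delta>T u\<close> acted on by
    \<open>\<Delta>E (\<psi> t)\<close>. It serves both the cocycle identity and the final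
    isomorphism.\<close>
  have twist_\<psi>: "twist E H \<Delta>E X (\<psi> t) = \<Psi> (\<Delta>T t)" if t: "t \<in> mcar T" for t
    using \<Delta>T_act[OF u klinear_closed[OF \<psi> t]] \<theta>\<psi>[OF t] \<Psi>_act[OF \<Delta>Tu, of "\<Delta>E (\<psi> t)"]
      klinear_closed[OF \<psi> t] by (simp add: twist_eq X_def)
  \<comment> \<open>The left side of the cocycle identity is the twisted coaction applied to the
    first factor of \<open>X\<close>; colinearity of \<open>\<psi>\<close> rewrites it through the
    iterated coaction of \<open>T\<close> at \<open>u\<close>.\<close>
  have "tpure (tensor E H) H X (mone H) \<odot> cd0 E H \<Delta>E X = tmap (tensor E H) H (twist E H \<Delta>E X) id (\<Psi> (\<Delta>T u))"
    using tmap_twist[OF X X] by (simp add: X_def)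
  also have "\<dots> = tmap (tensor E H) H (\<lambda>t. twist E H \<Delta>E X (\<psi> t)) id (\<Delta>T u)"
    using tmap_tmap[OF Tm Hm Em Hm kmodule_tensor Hm \<psi> klinear_id(1) klinear_twist[OF X] klinear_id(1) \<Delta>Tu]
    by (simp add: \<Psi>_def id_def)
  also have "\<dots> = tmap (tensor E H) H (\<lambda>t. \<Psi> (\<Delta>T t)) id (\<Delta>T u)"
    by (rule tmap_cong[OF Tm Hm kmodule_tensor Hm klinear_compose[OF \<psi> klinear_twist[OF X]]
          klinear_compose[OF \<Delta>T \<Psi>] klinear_id(1) twist_\<psi> \<Delta>Tu])
  also have "\<dots> = tmap (tensor E H) H \<Psi> id (tmap (tensor T H) H \<Delta>T id (\<Delta>T u))"
    using tmap_tmap[OF Tm Hm kmodule_tensor Hm kmodule_tensor Hm \<Delta>T klinear_id(1) \<Psi> klinear_id(1) \<Delta>Tu]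
    by (simp add: id_def)
  also have "\<dots> = assoc_inv E H H (tmap E (tensor H H) \<psi> id (tmap T (tensor H H) id \<Delta> (\<Delta>T u)))"
    unfolding coassoc[OF u] \<Psi>_def
    by (rule assoc_inv_natural[OF Tm Hm Hm Em \<psi>
          klinear_closed[OF klinear_tmap[OF Tm Hm Tm kmodule_tensor klinear_id(1) \<Delta>_linear] \<Delta>Tu]])
  \<comment> \<open>The maps \<open>\<psi> \<otimes> id\<close> and
    \<open>id \<otimes> \<Delta>\<close> commute: either order of composition gives
    \<open>\<psi> \<otimes> \<Delta>\<close>.\<close>
  also have "\<dots> = cd1 E H \<Delta> X"
    using tmap_tmap[OF Tm Hm Tm kmodule_tensor Em kmodule_tensor klinear_id(1) \<Delta>_linear \<psi> klinear_id(1) \<Delta>Tu]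
      tmap_tmap[OF Tm Hm Em Hm Em kmodule_tensor \<psi> klinear_id(1) klinear_id(1) \<Delta>_linear \<Delta>Tu]
    by (simp add: cd1_def X_def \<Psi>_def id_def)
  finally have "X \<in> Z1 H \<Delta> E \<Delta>E" using unit by (simp add: Z1_iff)
  moreover have "hm_iso H E T act \<Delta>T E (mmul E) (twist E H \<Delta>E X)"
    unfolding hm_iso_def
    using bij_betw_inv_into[OF bij_u] \<psi> \<psi>_act twist_\<psi>
    by (intro exI[of _ \<psi>]) (simp add: \<psi>_def[symmetric] \<Psi>_def)
  ultimately show ?thesis by blast
qed

lemma one2_cocycle: "one2 \<in> Z1 H \<Delta> E \<Delta>E"
proof -
  have "one2 \<in> alg_units (tensor_alg E H)" by (auto simp: alg_units_def)
  moreover have "tpure (tensor E H) H one2 (mone H) \<odot> cd0 E H \<Delta>E one2 = cd1 E H \<Delta> one2"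
    by (simp add: cd0_tpure cd1_tpure \<Delta>E_one \<Delta>_one assoc_inv_tpure pure3)
  ultimately show ?thesis by (simp add: Z1_iff)
qed

end

text \<open>Classes are expressed by the relations \<open>cohomologous\<close> and
  \<open>hm_iso\<close> rather than by quotient sets, which lets the carrier type of
  \<open>T\<close> be unrelated to that of \<open>E\<close>.\<close>

theorem theorem3p4:
  fixes H :: "('k::field, 'h) kalg" and \<Delta> :: "'h \<Rightarrow> ('h \<times> 'h \<Rightarrow> 'k) set"
    and \<epsilon> :: "'h \<Rightarrow> 'k" and S :: "'h \<Rightarrow> 'h"
    and E :: "('k, 'e) kalg" and \<Delta>E :: "'e \<Rightarrow> ('e \<times> 'h \<Rightarrow> 'k) set"
  assumes "hopf_algebra H \<Delta> \<epsilon> S"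
    and "comodule_algebra H \<Delta> \<epsilon> E \<Delta>E"
  shows
    \<comment> \<open>each cocycle X gives a torsor (E, Delta_E^X)\<close>
    "(\<forall>X\<in>Z1 H \<Delta> E \<Delta>E. hopf_torsor H \<Delta> \<epsilon> E \<Delta>E E (mmul E) (twist E H \<Delta>E X))
     \<comment> \<open>well defined and injective on cohomology classes\<close>
   \<and> (\<forall>X\<in>Z1 H \<Delta> E \<Delta>E. \<forall>Y\<in>Z1 H \<Delta> E \<Delta>E.
        cohomologous H E \<Delta>E X Y \<longleftrightarrow>
        hm_iso H E E (mmul E) (twist E H \<Delta>E X) E (mmul E) (twist E H \<Delta>E Y))
     \<comment> \<open>surjective onto isomorphism classes of torsors (of any carrier type)\<close>
   \<and> (\<forall>(T :: ('k, 't) kmod) act \<Delta>T. hopf_torsor H \<Delta> \<epsilon> E \<Delta>E T act \<Delta>T \<longrightarrow>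
        (\<exists>X\<in>Z1 H \<Delta> E \<Delta>E. hm_iso H E T act \<Delta>T E (mmul E) (twist E H \<Delta>E X)))
     \<comment> \<open>pointed: the base point 1 (x) 1 is a cocycle and maps to (E, Delta_E)\<close>
   \<and> tpure E H (mone E) (mone H) \<in> Z1 H \<Delta> E \<Delta>E
   \<and> (\<forall>x\<in>mcar E. twist E H \<Delta>E (tpure E H (mone E) (mone H)) x = \<Delta>E x)"
proof -
  interpret hopf_comodule_algebra H \<Delta> \<epsilon> S E \<Delta>E
    using assms by unfold_locales
  show ?thesis
    by (intro conjI ballI allI impI torsor_twist cohomologous_iff_iso torsor_iso_twist one2_cocycle Z1_closed)
      (simp_all add: twist_eq)
qed

end
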